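(* Let $\mathcal G$ be a connected, compact, finite metric graph of total length $L$ and discrete edge connectivity $\eta$, and let $p\in(1,\infty)$. Put $\pi_p:=\dfrac{2\pi}{p\sin(\pi/p)}$. If $\eta\ge 2$, then $$\mu_1^{(p)}(\mathcal G)\ \ge\ (p-1)\left(\frac{2\pi_p}{L}\right)^p .$$ Moreover, if $\eta\ge 3$, then $$\mu_1^{(p)}(\mathcal G)\ \ge\ (p-1)\left(\frac{\eta\,\pi_p}{L+\ell_{\max}(\eta-2)}\right)^p,$$ where $\ell_{\max}$ is the length of the longest edge of $\mathcal G$.
   Context: A metric graph $\mathcal G$ here is connected and consists of finitely many edges of finite length (each edge $e$ identified with an interval $[0,\ell_e]$), joined at finitely many vertices; loops and multiple edges are allowed. It is assumed that $\mathcal G$ has no vertices of degree two (such a vertex can be suppressed by merging its two incident edges into one edge without affecting the problem), the only exception being the cycle graph, viewed as one vertex with one loop. $L$ is the sum of the edge lengths. Discrete edge connectivity $\eta$: after suppressing all vertices of degree two (if possible), if the resulting graph has more than one vertex, $\eta$ is the minimal number of edges that need to be deleted in order to make it disconnected; if it has only one vertex (a flower graph, including the cycle graph), set $\eta=2$. $W^{1,p}(\mathcal G)$ is the space of continuous functions on $\mathcal G$ whose restriction to each edge is in $W^{1,p}$. A number $\mu>0$ is an eigenvalue (of the $p$-Laplacian with natural vertex conditions) if there is $0\neq\psi\in W^{1,p}(\mathcal G)$ with $$\int_{\mathcal G}|\psi'|^{p-2}\psi' u'\,dx=\mu\int_{\mathcal G}|\psi|^{p-2}\psi u\,dx\qquad\text{for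 all }u\in W^{1,p}(\mathcal G),$$ and $\mu_1^{(p)}(\mathcal G):=\inf\{\mu>0:\mu\text{ is an eigenvalue}\}$. *)

theory Defs
  imports "HOL-Analysis.Analysis" "Graph_Theory.Digraph_Component"
begin

text \<open>
  The combinatorial graph is a finite multigraph whose edges carry an arbitrary orientation:
  the edge \<open>e\<close> is the interval from \<open>0\<close> (at \<open>tail G e\<close>) to \<open>len e\<close> (at \<open>head G e\<close>). The constant
  \<open>Digraph_Component.connected\<close> ignores the orientation, and the sum of the in- and out-degree
  is the degree, where a loop counts twice. A graph with a single vertex and a single edge is
  the cycle graph, the only one that may have a vertex of degree two.
\<close>

locale metric_graph = fin_digraph G for G :: "('v, 'e) pre_digraph" +
  fixes len :: "'e \<Rightarrow> real"
  assumes connected: "Digraph_Component.connected G"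
    and arcs_nonempty: "arcs G \<noteq> {}"
    and len_pos: "e \<in> arcs G \<Longrightarrow> 0 < len e"
    and no_degree_two: "v \<in> verts G \<Longrightarrow> in_degree G v + out_degree G v = 2 \<Longrightarrow>
          card (verts G) = 1 \<and> card (arcs G) = 1"

definition total_length :: "('v, 'e) pre_digraph \<Rightarrow> ('e \<Rightarrow> real) \<Rightarrow> real" where
  "total_length G len = (\<Sum>e\<in>arcs G. len e)"

definition max_length :: "('v, 'e) pre_digraph \<Rightarrow> ('e \<Rightarrow> real) \<Rightarrow> real" where
  "max_length G len = Max (len ` arcs G)"

text \<open>No vertices are suppressed here, since a \<open>metric_graph\<close> has none that could be.\<close>

definition edge_connectivity :: "('v, 'e) pre_digraph \<Rightarrow> nat" where
  "edge_connectivity G =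
    (if card (verts G) > 1
     then LEAST k. \<exists>F \<subseteq> arcs G. card F = k \<and>
            \<not> Digraph_Component.connected (G\<lparr>arcs := arcs G - F\<rparr>)
     else 2)"

definition Lp_fun :: "real \<Rightarrow> real \<Rightarrow> (real \<Rightarrow> real) \<Rightarrow> bool" where
  "Lp_fun p l f \<longleftrightarrow> set_borel_measurable lborel {0<..<l} f \<and>
     set_integrable lborel {0<..<l} (\<lambda>x. \<bar>f x\<bar> powr p)"

definition test_function :: "real \<Rightarrow> (real \<Rightarrow> real) \<Rightarrow> bool" where
  "test_function l \<phi> \<longleftrightarrow> (\<forall>x. \<phi> differentiable (at x)) \<and> continuous_on UNIV (deriv \<phi>) \<and>
     (\<exists>K. compact K \<and> K \<subseteq> {0<..<l} \<and> (\<forall>x. x \<notin> K \<longrightarrow> \<phi> x = 0))"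

text \<open>
  \<open>f \<in> W\<^sup>1\<^sup>,\<^sup>p(0,l)\<close> with weak derivative \<open>f'\<close>. As is common on intervals (e.g. in Brezis' book),
  the test functions are continuously differentiable with compact support in \<open>(0,l)\<close>.
\<close>

definition sobolev_deriv :: "real \<Rightarrow> real \<Rightarrow> (real \<Rightarrow> real) \<Rightarrow> (real \<Rightarrow> real) \<Rightarrow> bool" where
  "sobolev_deriv p l f f' \<longleftrightarrow> Lp_fun p l f \<and> Lp_fun p l f' \<and>
     (\<forall>\<phi>. test_function l \<phi> \<longrightarrow>
        (LBINT x:{0<..<l}. f x * deriv \<phi> x) = - (LBINT x:{0<..<l}. f' x * \<phi> x))"

text \<open>
  A function on the metric graph is a family of functions on the intervals \<open>[0, len e]\<close>; \<open>c v\<close> is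
  its value at the vertex \<open>v\<close>.
\<close>

definition continuous_on_graph ::
  "('v, 'e) pre_digraph \<Rightarrow> ('e \<Rightarrow> real) \<Rightarrow> ('e \<Rightarrow> real \<Rightarrow> real) \<Rightarrow> bool" where
  "continuous_on_graph G len u \<longleftrightarrow>
     (\<forall>e\<in>arcs G. continuous_on {0..len e} (u e)) \<and>
     (\<exists>c. \<forall>e\<in>arcs G. u e 0 = c (tail G e) \<and> u e (len e) = c (head G e))"

text \<open>\<open>u \<in> W\<^sup>1\<^sup>,\<^sup>p(G)\<close> with edgewise weak derivative \<open>u'\<close> (which is unique almost everywhere).\<close>

definition W1p_graph ::
  "('v, 'e) pre_digraph \<Rightarrow> ('e \<Rightarrow> real) \<Rightarrow> real \<Rightarrow> ('e \<Rightarrow> real \<Rightarrow> real) \<Rightarrow> ('e \<Rightarrow> real \<Rightarrow> real) \<Rightarrow> bool"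
  where
  "W1p_graph G len p u u' \<longleftrightarrow> continuous_on_graph G len u \<and>
     (\<forall>e\<in>arcs G. sobolev_deriv p (len e) (u e) (u' e))"

definition graph_integral ::
  "('v, 'e) pre_digraph \<Rightarrow> ('e \<Rightarrow> real) \<Rightarrow> ('e \<Rightarrow> real \<Rightarrow> real) \<Rightarrow> real" where
  "graph_integral G len h = (\<Sum>e\<in>arcs G. LBINT x:{0<..<len e}. h e x)"

definition p_eigenvalue :: "('v, 'e) pre_digraph \<Rightarrow> ('e \<Rightarrow> real) \<Rightarrow> real \<Rightarrow> real \<Rightarrow> bool" where
  "p_eigenvalue G len p \<mu> \<longleftrightarrow>
     (\<exists>\<psi> \<psi>'. W1p_graph G len p \<psi> \<psi>' \<and> (\<exists>e\<in>arcs G. \<exists>x\<in>{0..len e}. \<psi> e x \<noteq> 0) \<and>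
        (\<forall>u u'. W1p_graph G len p u u' \<longrightarrow>
           graph_integral G len (\<lambda>e x. \<bar>\<psi>' e x\<bar> powr (p - 2) * \<psi>' e x * u' e x) =
           \<mu> * graph_integral G len (\<lambda>e x. \<bar>\<psi> e x\<bar> powr (p - 2) * \<psi> e x * u e x)))"

text \<open>
  The infimum is taken in the extended reals, with the usual convention that the infimum of the
  empty set is infinite.
\<close>

definition mu1 :: "('v, 'e) pre_digraph \<Rightarrow> ('e \<Rightarrow> real) \<Rightarrow> real \<Rightarrow> ereal" where
  "mu1 G len p = (INF \<mu>\<in>{\<mu>. 0 < \<mu> \<and> p_eigenvalue G len p \<mu>}. ereal \<mu>)"

definition pi_p :: "real \<Rightarrow> real" where
  "pi_p p = 2 * pi / (p * sin (pi / p))"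

end

theory Submission
  imports Defs
begin

text \<open>
Let \<open>\<psi>\<close> be an eigenfunction with eigenvalue \<open>\<mu> = (p - 1) \<kappa>\<close>, let \<open>\<Omega> = {\<psi> > 0}\<close> and let \<open>M\<close> be
the maximum of \<open>\<psi>\<close>. The classical way to bound \<open>\<mu>\<close> from below is to rearrange \<open>\<psi>\<close> into a decreasing
function on an interval. Here the rearrangement is replaced by a calibration: Young's inequality
\<open>|y|^p \<ge> p A^(p-1) |y| - (p-1) A^p\<close> is applied at every point with \<open>y = \<psi>'\<close> and with the slope
\<open>A^p = \<kappa> (M^p - \<psi>^p)\<close>. This is the slope which a generalized sine with amplitude \<open>M\<close>, the extremal
function on an interval, has where its value is \<open>\<psi>\<close>, so that nothing is lost for that function.
Put \<open>h'(t) = (M^p - t^p)^(1-1/p)\<close>. Testing the eigenvalue equation with the positive part of \<open>\<psi>\<close> and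
inserting the inequality, all powers of \<open>\<psi>\<close> cancel, and what remains bounds \<open>\<mu> M^p |\<Omega>|\<close> from below by
\<open>p \<kappa>^(1-1/p)\<close> times the total variation of \<open>h(\<psi>)\<close> on \<open>\<Omega>\<close>. If every value between \<open>0\<close> and \<open>M\<close> is taken
at least \<open>m\<close> times, this variation is at least \<open>m (h(M) - h(0))\<close>, and \<open>h(M) - h(0)\<close> is a Beta
integral that equals \<open>M^p (p-1) pi_p / (2p)\<close>. The outcome is \<open>m pi_p / 2 \<le> \<kappa>^(1/p) |\<Omega>|\<close>. Since \<open>\<psi>\<close>
changes sign, one may assume \<open>|\<Omega>| \<le> L/2\<close> after replacing \<open>\<psi>\<close> by \<open>-\<psi>\<close>.

How often is a value taken? A level between two vertex values separates the vertices above it from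
those below it, so it is crossed on at least \<open>\<eta>\<close> edges
(\<open>edge_connectivity_mult_oscillation_le\<close>). A level above the largest vertex value \<open>b\<close> is only known to
be crossed twice, on the edge \<open>es\<close> that carries the maximum. The test function makes up for this:
it equals the positive part of \<open>\<psi>\<close> up to height \<open>b\<close>; above \<open>b\<close> it continues with slope \<open>m/2\<close> on \<open>es\<close> and
stays constant on all other edges. Then the levels above \<open>b\<close> also count \<open>m\<close> times, at the price of
replacing \<open>|\<Omega>|\<close> by \<open>|\<Omega>| + (m/2 - 1) len es\<close>. This is \<open>superlevel_length_estimate\<close>, the core of the
proof, and with \<open>|\<Omega>| \<le> L/2\<close> it is the claim, for \<open>m = 2\<close> and for \<open>m = \<eta>\<close>.

Levels below the smallest vertex value are also crossed only twice in general. This does no harm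
for \<open>m = 2\<close>, and there are no such positive levels unless \<open>\<psi>\<close> is positive at all vertices. In that
case either \<open>L \<le> 2 l_max\<close>, and the estimate for \<open>m = 2\<close> implies the one for \<open>m = \<eta>\<close>; or one uses
\<open>-\<psi>\<close>, which is positive in the interior of edges only. For such a function the cut condition is void,
\<open>m\<close> may tend to infinity, and \<open>pi_p \<le> \<kappa>^(1/p) l_max\<close> results, which is again better than needed
(\<open>weak_eigenfunction_root_bound\<close>).

The test function is a piecewise linear function of \<open>\<psi>\<close>, and the variation of \<open>h(\<psi>)\<close> has to be computed
from the weak derivative of \<open>\<psi>\<close>. Both rest on the fact that a continuous Sobolev function on an
interval is the indefinite integral of its weak derivative, and conversely.
\<close>

section \<open>Indefinite integrals and their chain rule\<close>

lemma set_integrable_Ioo_subset: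
  fixes g :: "real \<Rightarrow> real"
  assumes "set_integrable lborel {a<..<b} g" "a \<le> x" "y \<le> b"
  shows "set_integrable lborel {x<..<y} g"
  by (rule set_integrable_subset[OF assms(1)]) (use assms in auto)

text \<open>
Open intervals are used throughout, as in the integrals that define the weak derivative; the
missing point \<open>b\<close> is a null set.
\<close>

lemma integral_Ioo_split:
  fixes g :: "real \<Rightarrow> real"
  assumes "set_integrable lborel {a<..<c} g" "a \<le> b" "b \<le> c"
  shows "(LBINT t:{a<..<c}. g t) = (LBINT t:{a<..<b}. g t) + (LBINT t:{b<..<c}. g t)"
proof -
  have "(LBINT x=ereal a..ereal b. g x) + (LBINT x=ereal b..ereal c. g x) = (LBINT x=ereal a..ereal c. g x)"
    by (rule interval_integral_sum)
      (use assms in \<open>auto simp: interval_lebesgue_integrable_def min_def max_def einterval_eq\<close>)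
  then show ?thesis using assms
    by (simp add: interval_integral_Ioo)
qed

lemma continuous_mult_set_integrable:
  fixes k g :: "real \<Rightarrow> real"
  assumes "continuous_on {0..l} k" "set_integrable lborel {0<..<l} g"
  shows "set_integrable lborel {0<..<l} (\<lambda>t. k t * g t)"
proof -
  have "bounded (k ` {0..l})" using assms(1) compact_Icc compact_continuous_image compact_imp_bounded by blast
  then obtain B where B: "\<And>t. t \<in> {0..l} \<Longrightarrow> \<bar>k t\<bar> \<le> B" unfolding bounded_iff by fastforce
  have m: "set_borel_measurable lborel {0<..<l} k"
    unfolding set_borel_measurable_def
    using borel_measurable_continuous_on_indicator[OF _ continuous_on_subset[OF assms(1)], of "{0<..<l}"]
    by (simp add: greaterThanLessThan_subseteq_atLeastAtMost_iff)
  have mg: "set_borel_measurable lborel {0<..<l} g"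
    using assms(2) unfolding set_integrable_def set_borel_measurable_def by auto
  have m2: "set_borel_measurable lborel {0<..<l} (\<lambda>t. k t * g t)"
  proof -
    have "(\<lambda>x. (indicat_real {0<..<l} x *\<^sub>R k x) * (indicat_real {0<..<l} x *\<^sub>R g x)) \<in> borel_measurable lborel"
      using m mg unfolding set_borel_measurable_def by (rule borel_measurable_times)
    also have "(\<lambda>x. (indicat_real {0<..<l} x *\<^sub>R k x) * (indicat_real {0<..<l} x *\<^sub>R g x))
       = (\<lambda>x. indicat_real {0<..<l} x *\<^sub>R (k x * g x))" by (auto simp: indicator_def)
    finally show ?thesis unfolding set_borel_measurable_def .
  qed
  show ?thesis
  proof (rule set_integrable_bound[of _ _ "\<lambda>t. B * g t"])
    show "set_integrable lborel {0<..<l} (\<lambda>t. B * g t)" using assms(2) by simp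
    show "AE x in lborel. x \<in> {0<..<l} \<longrightarrow> norm (k x * g x) \<le> norm (B * g x)"
    proof (intro AE_I2 impI)
      fix x assume "x \<in> {0<..<l}"
      then have "\<bar>k x\<bar> \<le> B" using B[of x] by auto
      then have "\<bar>k x\<bar> * \<bar>g x\<bar> \<le> \<bar>B\<bar> * \<bar>g x\<bar>" by (intro mult_right_mono) auto
      then show "norm (k x * g x) \<le> norm (B * g x)" by (simp add: abs_mult)
    qed
  qed (rule m2)
qed

text \<open>
Absolute continuity of \<open>f\<close> on \<open>[0, l]\<close>, with \<open>g\<close> as a representative of the derivative.
\<close>

definition primitive_on :: "real \<Rightarrow> (real \<Rightarrow> real) \<Rightarrow> (real \<Rightarrow> real) \<Rightarrow> bool" where
  "primitive_on l f g \<longleftrightarrow> continuous_on {0..l} f \<and> set_integrable lborel {0<..<l} g \<and>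
     (\<forall>x y. 0 \<le> x \<and> x \<le> y \<and> y \<le> l \<longrightarrow> f y - f x = (LBINT t:{x<..<y}. g t))"

lemma primitive_onD:
  assumes "primitive_on l f g"
  shows "continuous_on {0..l} f" "set_integrable lborel {0<..<l} g"
    "0 \<le> x \<Longrightarrow> x \<le> y \<Longrightarrow> y \<le> l \<Longrightarrow> f y - f x = (LBINT t:{x<..<y}. g t)"
    "0 \<le> x \<Longrightarrow> x \<le> y \<Longrightarrow> y \<le> l \<Longrightarrow> set_integrable lborel {x<..<y} g"
  using assms set_integrable_Ioo_subset unfolding primitive_on_def by blast+

lemma primitive_on_add:
  assumes "primitive_on l f1 g1" "primitive_on l f2 g2"
  shows "primitive_on l (\<lambda>x. f1 x + f2 x) (\<lambda>x. g1 x + g2 x)"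
proof -
  note 1 = primitive_onD[OF assms(1)] and 2 = primitive_onD[OF assms(2)]
  show ?thesis unfolding primitive_on_def
  proof (intro conjI allI impI)
    fix x y assume xy: "0 \<le> x \<and> x \<le> y \<and> y \<le> l"
    show "f1 y + f2 y - (f1 x + f2 x) = (LBINT t:{x<..<y}. g1 t + g2 t)"
      using 1(3,4)[of x y] 2(3,4)[of x y] xy by (simp add: set_integral_add(2))
  qed (use 1 2 in \<open>simp_all add: continuous_on_add set_integral_add(1)\<close>)
qed

lemma primitive_on_cmult:
  assumes "primitive_on l f g"
  shows "primitive_on l (\<lambda>x. c * f x) (\<lambda>x. c * g x)"
proof -
  note 1 = primitive_onD[OF assms(1)]
  show ?thesis unfolding primitive_on_def
  proof (intro conjI allI impI)
    fix x y assume xy: "0 \<le> x \<and> x \<le> y \<and> y \<le> l"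
    have "c * f y - c * f x = c * (f y - f x)" by (simp add: algebra_simps)
    also have "\<dots> = (LBINT t:{x<..<y}. c * g t)"
      using 1(3)[of x y] xy by simp
    finally show "c * f y - c * f x = (LBINT t:{x<..<y}. c * g t)" .
  next
    show "continuous_on {0..l} (\<lambda>x. c * f x)" by (rule continuous_on_mult_left[OF 1(1)])
    show "set_integrable lborel {0<..<l} (\<lambda>x. c * g x)" using 1(2) by simp
  qed
qed

lemma primitive_on_const: "primitive_on l (\<lambda>x. c) (\<lambda>x. 0)"
  unfolding primitive_on_def by (simp add: set_integrable_def set_lebesgue_integral_def)

lemma primitive_on_cong:
  assumes "primitive_on l f g" "\<And>x. x \<in> {0..l} \<Longrightarrow> f x = f' x" "\<And>x. x \<in> {0<..<l} \<Longrightarrow> g x = g' x"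
  shows "primitive_on l f' g'"
proof -
  note 1 = primitive_onD[OF assms(1)]
  show ?thesis unfolding primitive_on_def
  proof (intro conjI allI impI)
    show "continuous_on {0..l} f'" by (rule continuous_on_eq[OF 1(1) assms(2)])
    show "set_integrable lborel {0<..<l} g'" using 1(2) assms(3)
      by (subst set_integrable_cong[OF refl refl, of _ _ g]) auto
    fix x y assume xy: "0 \<le> x \<and> x \<le> y \<and> y \<le> l"
    have "(LBINT t:{x<..<y}. g t) = (LBINT t:{x<..<y}. g' t)"
      by (rule set_lebesgue_integral_cong) (use assms(3) xy in auto)
    then show "f' y - f' x = (LBINT t:{x<..<y}. g' t)"
      using 1(3)[of x y] xy assms(2)[of x] assms(2)[of y] by simp
  qed
qed

lemma primitive_on_C1:
  assumes "\<And>x. (f has_real_derivative f' x) (at x)" "continuous_on UNIV f'"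
  shows "primitive_on l f f'"
  unfolding primitive_on_def
proof (intro conjI allI impI)
  show "continuous_on {0..l} f" by (rule DERIV_continuous_on[OF has_field_derivative_at_within[OF assms(1)]])
  have c: "continuous_on {x..y} f'" for x y using assms(2) continuous_on_subset by blast
  show "set_integrable lborel {0<..<l} f'"
    using borel_integrable_atLeastAtMost'[OF c[of 0 l]] by (rule set_integrable_subset) auto
  fix x y assume xy: "0 \<le> x \<and> x \<le> y \<and> y \<le> l"
  have "(LBINT t=ereal x..ereal y. f' t) = f y - f x"
    by (rule interval_integral_FTC_finite)
      (use c xy assms(1) in \<open>auto simp: has_real_derivative_iff_has_vector_derivative[symmetric] intro: has_field_derivative_at_within\<close>)
  then show "f y - f x = (LBINT t:{x<..<y}. f' t)" using xy by (simp add: interval_integral_Ioo)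
qed

text \<open>
On a short interval the mean value theorem gives \<open>H(f b) - H(f a) = k(z) (f b - f a)\<close> for some \<open>z\<close>
between \<open>f a\<close> and \<open>f b\<close>, and \<open>f b - f a\<close> is the integral of \<open>g\<close>. By uniform continuity \<open>k(z)\<close> differs
from \<open>k \<circ> f\<close> by less than \<open>e\<close> on that interval, so the error is at most \<open>e\<close> times the integral of \<open>|g|\<close>.
Such errors add up over adjacent intervals, so this bound holds on long intervals too; then \<open>e\<close>
tends to \<open>0\<close>.
\<close>

lemma primitive_on_compose_C1:
  assumes f: "primitive_on l f g"
    and H: "\<And>t. (H has_real_derivative k t) (at t)" and k: "continuous_on UNIV k"
  shows "primitive_on l (\<lambda>x. H (f x)) (\<lambda>x. k (f x) * g x)"
proof -
  note fD = primitive_onD[OF f]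
  have cH: "continuous_on UNIV H" by (rule DERIV_continuous_on[OF has_field_derivative_at_within[OF H]])
  have ckf: "continuous_on {0..l} (\<lambda>x. k (f x))"
    using continuous_on_compose2[OF k fD(1)] by auto
  have int: "set_integrable lborel {0<..<l} (\<lambda>x. k (f x) * g x)"
    by (rule continuous_mult_set_integrable[OF ckf fD(2)])
  have iabs: "set_integrable lborel {0<..<l} (\<lambda>x. \<bar>g x\<bar>)" using fD(2) by (rule set_integrable_abs)
  have "H (f y) - H (f x) = (LBINT t:{x<..<y}. k (f t) * g t)" if xy: "0 \<le> x" "x \<le> y" "y \<le> l" for x y
  proof -
    \<comment> \<open>the defect of the claim on \<open>[a, b]\<close>, and the quantity that controls it; both are additive\<close>
    define D where "D a b = H (f b) - H (f a) - (LBINT t:{a<..<b}. k (f t) * g t)" for a b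
    define W where "W a b = (LBINT t:{a<..<b}. \<bar>g t\<bar>)" for a b
    have D_add: "D a c = D a b + D b c" if "0 \<le> a" "a \<le> b" "b \<le> c" "c \<le> l" for a b c
      unfolding D_def using integral_Ioo_split[OF set_integrable_Ioo_subset[OF int, of a c], of b] that by auto
    have W_add: "W a c = W a b + W b c" if "0 \<le> a" "a \<le> b" "b \<le> c" "c \<le> l" for a b c
      unfolding W_def using integral_Ioo_split[OF set_integrable_Ioo_subset[OF iabs, of a c], of b] that by auto
    have bound: "\<bar>D x y\<bar> \<le> e * W x y" if e: "0 < e" for e
    proof -
      have "compact (f ` {0..l})" using fD(1) compact_continuous_image compact_Icc by blast
      then obtain B where B: "\<And>t. t \<in> {0..l} \<Longrightarrow> \<bar>f t\<bar> \<le> B"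
        using compact_imp_bounded[of "f ` {0..l}"] unfolding bounded_iff by fastforce
      have "uniformly_continuous_on {-B..B} k"
        by (intro compact_uniformly_continuous continuous_on_subset[OF k]) auto
      then obtain w where w: "w > 0" "\<And>s t. s \<in> {-B..B} \<Longrightarrow> t \<in> {-B..B} \<Longrightarrow> \<bar>s - t\<bar> < w \<Longrightarrow> \<bar>k s - k t\<bar> < e"
        unfolding uniformly_continuous_on_def dist_real_def using e by metis
      have "uniformly_continuous_on {0..l} f"
        by (intro compact_uniformly_continuous fD(1)) auto
      then obtain d where d: "d > 0" "\<And>s t. s \<in> {0..l} \<Longrightarrow> t \<in> {0..l} \<Longrightarrow> \<bar>s - t\<bar> < d \<Longrightarrow> \<bar>f s - f t\<bar> < w/2"
        unfolding uniformly_continuous_on_def dist_real_def using half_gt_zero[OF w(1)] by metis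
      have small: "\<bar>D a b\<bar> \<le> e * W a b" if ab: "0 \<le> a" "a \<le> b" "b \<le> l" "b - a < d" for a b
      proof -
        obtain z where z: "z \<in> {min (f a) (f b)..max (f a) (f b)}" "H (f b) - H (f a) = k z * (f b - f a)"
        proof (cases "f a = f b")
          case True then show ?thesis using that[of "f a"] by simp
        next
          case False
          then consider "f a < f b" | "f b < f a" by linarith
          then show ?thesis
          proof cases
            case 1
            then obtain z where "f a < z" "z < f b" "H (f b) - H (f a) = (f b - f a) * k z"
              using MVT2[of "f a" "f b" H k] H by auto
            then show ?thesis using that[of z] 1 by (auto simp: algebra_simps)
          next
            case 2
            then obtain z where "f b < z" "z < f a" "H (f a) - H (f b) = (f a - f b) * k z"
              using MVT2[of "f b" "f a" H k] H by auto
            then show ?thesis using that[of z] 2 by (auto simp: algebra_simps)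
          qed
        qed
        have ki: "set_integrable lborel {a<..<b} (\<lambda>t. k z * g t)"
          using set_integrable_Ioo_subset[OF fD(2), of a b] ab by auto
        have ki2: "set_integrable lborel {a<..<b} (\<lambda>t. k (f t) * g t)"
          using set_integrable_Ioo_subset[OF int, of a b] ab by auto
        have "D a b = (LBINT t:{a<..<b}. k z * g t) - (LBINT t:{a<..<b}. k (f t) * g t)"
          unfolding D_def z(2) using fD(3)[of a b] ab by simp
        also have "\<dots> = (LBINT t:{a<..<b}. k z * g t - k (f t) * g t)"
          using set_integral_diff(2)[OF ki ki2] by simp
        finally have Deq: "D a b = (LBINT t:{a<..<b}. k z * g t - k (f t) * g t)" .
        have "\<bar>D a b\<bar> \<le> (LBINT t:{a<..<b}. \<bar>k z * g t - k (f t) * g t\<bar>)"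
          unfolding Deq using set_integral_norm_bound[OF set_integral_diff(1)[OF ki ki2]] by simp
        also have "\<dots> \<le> (LBINT t:{a<..<b}. e * \<bar>g t\<bar>)"
        proof (rule set_integral_mono)
          show "set_integrable lborel {a<..<b} (\<lambda>t. \<bar>k z * g t - k (f t) * g t\<bar>)"
            by (rule set_integrable_abs[OF set_integral_diff(1)[OF ki ki2]])
          show "set_integrable lborel {a<..<b} (\<lambda>t. e * \<bar>g t\<bar>)"
            using set_integrable_Ioo_subset[OF iabs, of a b] ab by auto
          fix t assume t: "t \<in> {a<..<b}"
          have "\<bar>f a - f t\<bar> < w/2" "\<bar>f b - f t\<bar> < w/2"
            using d(2)[of a t] d(2)[of b t] t ab by auto
          moreover have zb: "min (f a) (f b) \<le> z" "z \<le> max (f a) (f b)" using z(1) by auto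
          ultimately have 1: "\<bar>z - f t\<bar> < w" by linarith
          have "\<bar>f a\<bar> \<le> B" "\<bar>f b\<bar> \<le> B" "\<bar>f t\<bar> \<le> B" using B[of a] B[of b] B[of t] t ab by auto
          then have "-B \<le> z" "z \<le> B" "-B \<le> f t" "f t \<le> B" using zb by linarith+
          then have "\<bar>k z - k (f t)\<bar> < e" using w(2)[of z "f t"] 1 by simp
          then have "\<bar>k z - k (f t)\<bar> * \<bar>g t\<bar> \<le> e * \<bar>g t\<bar>" by (intro mult_right_mono) auto
          then show "\<bar>k z * g t - k (f t) * g t\<bar> \<le> e * \<bar>g t\<bar>"
            by (simp only: abs_mult left_diff_distrib[symmetric])
        qed
        also have "\<dots> = e * W a b" unfolding W_def by simp
        finally show ?thesis .
      qed
      \<comment> \<open>induction over the number of pieces of length \<open>d/2\<close>, in addition to a remainder shorter than \<open>d/2\<close>\<close>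
      have steps: "\<forall>b. a \<le> b \<and> b \<le> l \<and> b - a < real n * d/2 + d/2 \<longrightarrow> \<bar>D a b\<bar> \<le> e * W a b" if a: "0 \<le> a" for a n
      proof (induction n)
        case 0 then show ?case using small a d(1) by auto
      next
        case (Suc n)
        show ?case
        proof (intro allI impI)
          fix b assume b: "a \<le> b \<and> b \<le> l \<and> b - a < real (Suc n) * d/2 + d/2"
          define c where "c = max a (b - d/2)"
          have c: "a \<le> c" "c \<le> b" "b - c < d" "c - a < real n * d/2 + d/2"
          proof -
            have "0 \<le> real n * d" using d(1) by simp
            moreover have "real (Suc n) * d / 2 = real n * d / 2 + d / 2" by (simp add: field_simps)
            then have "b - a < real n * d / 2 + d" using b by linarith
            ultimately show "a \<le> c" "c \<le> b" "b - c < d" "c - a < real n * d/2 + d/2"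
              using b d(1) unfolding c_def by linarith+
          qed
          have "\<bar>D a c\<bar> \<le> e * W a c" using Suc c b by auto
          moreover have "\<bar>D c b\<bar> \<le> e * W c b" using small[of c b] c b a by auto
          ultimately show "\<bar>D a b\<bar> \<le> e * W a b"
            using D_add[of a c b] W_add[of a c b] a c b by (simp add: algebra_simps)
        qed
      qed
      obtain n where "real n > 2*(y - x)/d" using reals_Archimedean2 by blast
      then have "y - x < real n * d/2 + d/2" using d(1) by (simp add: field_simps)
      then show ?thesis using steps[of x n] xy by auto
    qed
    have "\<bar>D x y\<bar> \<le> 0"
    proof (rule field_le_epsilon)
      fix e :: real assume e: "0 < e"
      have W0: "0 \<le> W x y" unfolding W_def set_lebesgue_integral_def by (rule integral_nonneg_AE) simp
      have "\<bar>D x y\<bar> \<le> e / (W x y + 1) * W x y" using bound[of "e / (W x y + 1)"] e W0 by auto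
      also have "\<dots> \<le> e" using e W0 by (simp add: field_simps)
      finally show "\<bar>D x y\<bar> \<le> 0 + e" by simp
    qed
    then show ?thesis unfolding D_def by simp
  qed
  then show ?thesis unfolding primitive_on_def using int continuous_on_compose2[OF cH fD(1)] by auto
qed

lemma primitive_on_square:
  assumes "primitive_on l f g" shows "primitive_on l (\<lambda>x. (f x)^2) (\<lambda>x. 2 * f x * g x)"
  by (rule primitive_on_compose_C1[OF assms, of "\<lambda>t. t^2" "\<lambda>t. 2 * t"])
    (auto intro!: derivative_eq_intros continuous_intros)

text \<open>
The product rule follows from the chain rule for the square by polarization.
\<close>

lemma primitive_on_mult:
  assumes "primitive_on l f1 g1" "primitive_on l f2 g2"
  shows "primitive_on l (\<lambda>x. f1 x * f2 x) (\<lambda>x. f1 x * g2 x + g1 x * f2 x)"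
proof -
  have s: "primitive_on l (\<lambda>x. (f1 x + f2 x)^2) (\<lambda>x. 2 * (f1 x + f2 x) * (g1 x + g2 x))"
    by (rule primitive_on_square[OF primitive_on_add[OF assms]])
  have d: "primitive_on l (\<lambda>x. (f1 x + (-1) * f2 x)^2) (\<lambda>x. 2 * (f1 x + (-1) * f2 x) * (g1 x + (-1) * g2 x))"
    by (rule primitive_on_square[OF primitive_on_add[OF assms(1) primitive_on_cmult[OF assms(2)]]])
  show ?thesis
    by (rule primitive_on_cong[OF primitive_on_cmult[OF primitive_on_add[OF s primitive_on_cmult[OF d, of "-1"]], of "1/4"]])
      (auto simp: power2_eq_square algebra_simps)
qed

text \<open>
Smooth approximations of the absolute value give the result in the limit, by dominated convergence.
Their kink is placed at \<open>c + d\<close> and is smoothed on the much shorter scale \<open>d^2\<close>. In this way the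
derivatives converge at every point, with limit \<open>-1\<close> at the value \<open>c\<close> itself, so that the limit also
determines a derivative on the set \<open>{f = c}\<close>, which may have positive measure.
\<close>

lemma primitive_on_abs:
  assumes f: "primitive_on l f g"
  shows "primitive_on l (\<lambda>x. \<bar>f x - c\<bar>) (\<lambda>x. (if f x > c then 1 else -1) * g x)"
proof -
  note fD = primitive_onD[OF f]
  define d where "d n = 1 / real (Suc n)" for n
  have dpos: "d n > 0" "d n \<le> 1" for n unfolding d_def by auto
  have dlim: "d \<longlonglongrightarrow> 0" unfolding d_def using LIMSEQ_inverse_real_of_nat by (simp add: inverse_eq_divide)
  define H where "H n t = sqrt ((t - c - d n)^2 + d n ^ 4)" for n t
  define k where "k n t = (t - c - d n) / H n t" for n t
  have pos: "(t - c - d n)^2 + d n ^ 4 > 0" for n t using dpos[of n] by (simp add: add_nonneg_pos)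
  have Hpos: "H n t > 0" for n t unfolding H_def using pos by simp
  have H: "(H n has_real_derivative k n t) (at t)" for n t
  proof -
    have "((\<lambda>t. (t - c - d n)^2 + d n ^ 4) has_real_derivative 2 * (t - c - d n)) (at t)"
      by (auto intro!: derivative_eq_intros)
    from DERIV_chain2[where f = sqrt and g = "\<lambda>t. (t - c - d n)^2 + d n ^ 4",
        OF DERIV_real_sqrt[OF pos[of t n]] this]
    have "(H n has_real_derivative inverse (H n t) / 2 * (2 * (t - c - d n))) (at t)"
      unfolding H_def .
    moreover have "inverse S / 2 * (2 * A) = A / S" for S A :: real by (simp add: inverse_eq_divide)
    ultimately show ?thesis unfolding k_def by (simp only:)

  qed
  have k: "continuous_on UNIV (k n)" for n
  proof -
    have "continuous_on UNIV (H n)" unfolding H_def by (intro continuous_intros)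
    moreover have "H n t \<noteq> 0" for t using Hpos[of n t] by simp
    ultimately show ?thesis unfolding k_def by (intro continuous_intros) auto
  qed
  have kb: "\<bar>k n t\<bar> \<le> 1" for n t
  proof -
    have "\<bar>t - c - d n\<bar> = sqrt ((t - c - d n)^2)" by simp
    also have "\<dots> \<le> H n t" unfolding H_def by (rule real_sqrt_le_mono) simp
    finally show ?thesis unfolding k_def using Hpos[of n t] by simp
  qed
  have Hlim: "(\<lambda>n. H n t) \<longlonglongrightarrow> \<bar>t - c\<bar>" for t
  proof -
    have "(\<lambda>n. H n t) \<longlonglongrightarrow> sqrt ((t - c - 0)^2 + 0^4)" unfolding H_def by (intro tendsto_intros dlim)
    then show ?thesis by simp
  qed
  have klim: "(\<lambda>n. k n t) \<longlonglongrightarrow> (if t > c then 1 else -1)" for t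
  proof (cases "t = c")
    case True
    have "k n t = - 1 / sqrt (1 + d n ^ 2)" for n
    proof -
      have "(c - c - d n)^2 + d n ^ 4 = d n ^2 * (1 + d n ^ 2)" by algebra
      then have "H n t = sqrt (d n ^2 * (1 + d n ^ 2))" unfolding H_def True by simp
      also have "\<dots> = d n * sqrt (1 + d n ^ 2)" using dpos[of n] by (simp add: real_sqrt_mult)
      finally show ?thesis unfolding k_def using True dpos(1)[of n] by simp
    qed
    moreover have "(\<lambda>n. - 1 / sqrt (1 + d n ^ 2)) \<longlonglongrightarrow> - 1 / sqrt (1 + 0^2)"
      by (intro tendsto_intros dlim) auto
    ultimately show ?thesis using True by simp
  next
    case False
    have "(\<lambda>n. k n t) \<longlonglongrightarrow> (t - c - 0) / \<bar>t - c\<bar>"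
      unfolding k_def using False by (intro tendsto_intros Hlim dlim) auto
    moreover have "(t - c - 0) / \<bar>t - c\<bar> = (if t > c then 1 else -1)"
      using False by (simp add: field_simps)
    ultimately show ?thesis by simp
  qed
  let ?k = "\<lambda>t. if f t > c then 1 else -1 :: real"
  have comp: "primitive_on l (\<lambda>x. H n (f x)) (\<lambda>x. k n (f x) * g x)" for n
    by (rule primitive_on_compose_C1[OF f H k])
  have dom: "set_integrable lborel {x<..<y} (\<lambda>t. ?k t * g t)"
     "(\<lambda>n. LBINT t:{x<..<y}. k n (f t) * g t) \<longlonglongrightarrow> (LBINT t:{x<..<y}. ?k t * g t)"
    if xy: "0 \<le> x" "x \<le> y" "y \<le> l" for x y
  proof -
    have m1: "(\<lambda>t. indicator {x<..<y} t *\<^sub>R (k n (f t) * g t)) \<in> borel_measurable lborel" for n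
      using primitive_onD(4)[OF comp[of n] xy] unfolding set_integrable_def by auto
    have L: "(\<lambda>n. indicator {x<..<y} t *\<^sub>R (k n (f t) * g t)) \<longlonglongrightarrow> indicator {x<..<y} t *\<^sub>R (?k t * g t)" for t
      using klim[of "f t"] by (intro tendsto_intros) auto
    have m2: "(\<lambda>t. indicator {x<..<y} t *\<^sub>R (?k t * g t)) \<in> borel_measurable lborel"
      by (rule borel_measurable_LIMSEQ_metric[OF m1 L])
    have wi: "integrable lborel (\<lambda>t. indicator {x<..<y} t *\<^sub>R \<bar>g t\<bar>)"
      using set_integrable_abs[OF fD(4)[OF xy]] unfolding set_integrable_def .
    have bd: "AE t in lborel. norm (indicator {x<..<y} t *\<^sub>R (k n (f t) * g t)) \<le> indicator {x<..<y} t *\<^sub>R \<bar>g t\<bar>" for n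
    proof (rule AE_I2)
      fix t have "\<bar>k n (f t)\<bar> * \<bar>g t\<bar> \<le> 1 * \<bar>g t\<bar>" by (intro mult_right_mono kb) auto
      then show "norm (indicator {x<..<y} t *\<^sub>R (k n (f t) * g t)) \<le> indicator {x<..<y} t *\<^sub>R \<bar>g t\<bar>"
        by (auto simp: indicator_def abs_mult)
    qed
    show "set_integrable lborel {x<..<y} (\<lambda>t. ?k t * g t)" unfolding set_integrable_def
      by (rule integrable_dominated_convergence[OF m2 m1 wi AE_I2[OF L] bd])
    show "(\<lambda>n. LBINT t:{x<..<y}. k n (f t) * g t) \<longlonglongrightarrow> (LBINT t:{x<..<y}. ?k t * g t)"
      unfolding set_lebesgue_integral_def
      by (rule integral_dominated_convergence[OF m2 m1 wi AE_I2[OF L] bd])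
  qed
  show ?thesis unfolding primitive_on_def
  proof (intro conjI allI impI)
    show "continuous_on {0..l} (\<lambda>x. \<bar>f x - c\<bar>)" by (intro continuous_intros fD(1))
    show "set_integrable lborel {0<..<l} (\<lambda>t. ?k t * g t)"
      by (cases "0 \<le> l") (use dom(1)[of 0 l] in \<open>auto simp: set_integrable_def\<close>)
    fix x y assume xy: "0 \<le> x \<and> x \<le> y \<and> y \<le> l"
    have "(\<lambda>n. H n (f y) - H n (f x)) \<longlonglongrightarrow> \<bar>f y - c\<bar> - \<bar>f x - c\<bar>"
      by (intro tendsto_intros Hlim)
    moreover have "H n (f y) - H n (f x) = (LBINT t:{x<..<y}. k n (f t) * g t)" for n
      using primitive_onD(3)[OF comp[of n]] xy by auto
    ultimately show "\<bar>f y - c\<bar> - \<bar>f x - c\<bar> = (LBINT t:{x<..<y}. ?k t * g t)"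
      using dom(2)[of x y] xy LIMSEQ_unique by fastforce
  qed
qed

lemma primitive_on_pos_part:
  assumes f: "primitive_on l f g"
  shows "primitive_on l (\<lambda>x. max (f x - c) 0) (\<lambda>x. (if f x > c then 1 else 0) * g x)"
  by (rule primitive_on_cong[OF primitive_on_cmult[OF primitive_on_add[OF primitive_on_add[OF f primitive_on_const[of _ "-c"]] primitive_on_abs[OF f, of c]], of "1/2"]])
    (auto simp: max_def abs_if)

section \<open>Sobolev functions on an interval\<close>

lemma primitive_on_imp_sobolev_deriv:
  assumes l: "0 < l" and p: "0 < p" and f: "primitive_on l f g" and g: "Lp_fun p l g"
  shows "sobolev_deriv p l f g"
proof -
  note fD = primitive_onD[OF f]
  have "continuous_on {0..l} (\<lambda>x. \<bar>f x\<bar> powr p)"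
    by (rule continuous_on_powr') (use p fD(1) in \<open>auto intro: continuous_on_rabs\<close>)
  then have "set_integrable lborel {0<..<l} (\<lambda>x. \<bar>f x\<bar> powr p)"
    by (rule set_integrable_subset[OF borel_integrable_atLeastAtMost']) auto
  moreover have "set_borel_measurable lborel {0<..<l} f"
    using borel_measurable_continuous_on_indicator[OF _ continuous_on_subset[OF fD(1)], of "{0<..<l}"]
    by (simp add: greaterThanLessThan_subseteq_atLeastAtMost_iff set_borel_measurable_def)
  ultimately have Lf: "Lp_fun p l f" unfolding Lp_fun_def by simp
  have "(LBINT x:{0<..<l}. f x * deriv \<phi> x) = - (LBINT x:{0<..<l}. g x * \<phi> x)"
    if t: "test_function l \<phi>" for \<phi>
  proof -
    from t have d: "(\<phi> has_real_derivative deriv \<phi> x) (at x)" for x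
      unfolding test_function_def by (simp add: DERIV_deriv_iff_real_differentiable)
    from t have c: "continuous_on UNIV (deriv \<phi>)" unfolding test_function_def by simp
    from t obtain K where K: "K \<subseteq> {0<..<l}" "\<And>x. x \<notin> K \<Longrightarrow> \<phi> x = 0" unfolding test_function_def by blast
    have "0 \<notin> K" "l \<notin> K" using K(1) by auto
    then have e: "\<phi> 0 = 0" "\<phi> l = 0" using K(2) by blast+
    have ph: "primitive_on l \<phi> (deriv \<phi>)" by (rule primitive_on_C1[OF d c])
    have i1: "set_integrable lborel {0<..<l} (\<lambda>x. f x * deriv \<phi> x)"
      by (rule continuous_mult_set_integrable[OF fD(1) primitive_onD(2)[OF ph]])
    have i2: "set_integrable lborel {0<..<l} (\<lambda>x. g x * \<phi> x)"
      using continuous_mult_set_integrable[OF primitive_onD(1)[OF ph] fD(2)] by (simp add: mult.commute)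
    have "f l * \<phi> l - f 0 * \<phi> 0 = (LBINT x:{0<..<l}. f x * deriv \<phi> x + g x * \<phi> x)"
      using primitive_onD(3)[OF primitive_on_mult[OF f ph], of 0 l] l by simp
    then show ?thesis using set_integral_add(2)[OF i1 i2] e by simp
  qed
  then show ?thesis unfolding sobolev_deriv_def using Lf g by blast
qed

lemma Lp_fun_imp_set_integrable:
  assumes p: "1 \<le> p" and f: "Lp_fun p l f"
  shows "set_integrable lborel {0<..<l} f"
proof (rule set_integrable_bound)
  show "set_integrable lborel {0<..<l} (\<lambda>x. 1 + \<bar>f x\<bar> powr p)"
  proof (rule set_integral_add(1))
    show "set_integrable lborel {0<..<l} (\<lambda>x. 1::real)"
      by (rule set_integrable_subset[OF borel_integrable_atLeastAtMost'[of 0 l]]) auto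
    show "set_integrable lborel {0<..<l} (\<lambda>x. \<bar>f x\<bar> powr p)" using f unfolding Lp_fun_def by simp
  qed
  show "set_borel_measurable lborel {0<..<l} f" using f unfolding Lp_fun_def by simp
  have "\<bar>y\<bar> \<le> 1 + \<bar>y\<bar> powr p" for y :: real
  proof (cases "\<bar>y\<bar> \<le> 1")
    case True
    moreover have "0 \<le> \<bar>y\<bar> powr p" by simp
    ultimately show ?thesis by linarith
  next
    case False
    then have "\<bar>y\<bar> powr 1 \<le> \<bar>y\<bar> powr p" using p by (intro powr_mono) auto
    then show ?thesis using False by simp
  qed
  then show "AE x in lborel. x \<in> {0<..<l} \<longrightarrow> norm (f x) \<le> norm (1 + \<bar>f x\<bar> powr p)"
    by (simp add: abs_of_nonneg add_nonneg_nonneg)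
qed

text \<open>
A continuous bump on \<open>[0, 1]\<close>. Its antiderivative is a continuously differentiable ramp, from which
admissible test functions for the weak derivative are built.
\<close>

definition tent :: "real \<Rightarrow> real" where
  "tent t = max 0 (min t (1 - t))"

lemma continuous_tent: "continuous_on A tent"
  unfolding tent_def by (intro continuous_intros)

lemma tent_nonneg: "0 \<le> tent t" unfolding tent_def by simp
lemma tent_zero: "t \<le> 0 \<or> 1 \<le> t \<Longrightarrow> tent t = 0" unfolding tent_def by auto

lemma tent_primitive:
  obtains S C where "\<And>t. (S has_real_derivative tent t) (at t)" "0 < C"
    "\<And>t. t \<le> 0 \<Longrightarrow> S t = (0::real)" "\<And>t. 1 \<le> t \<Longrightarrow> S t = C" "\<And>t. 0 \<le> S t" "\<And>t. S t \<le> C"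
    "integrable lborel tent" "integral\<^sup>L lborel tent = C"
proof -
  obtain S0 where S0: "\<And>t. (S0 has_real_derivative tent t) (at t)"
    using einterval_antiderivative[of "-\<infinity>" "\<infinity>" tent] continuous_tent[of UNIV]
    by (auto simp: continuous_on_eq_continuous_at has_real_derivative_iff_has_vector_derivative)
  define S where "S t = S0 t - S0 0" for t
  define C where "C = S 1"
  have S: "(S has_real_derivative tent t) (at t)" for t
    unfolding S_def using S0[of t] by (auto intro!: derivative_eq_intros)
  have c: "continuous_on A S" for A
    by (rule DERIV_continuous_on[OF has_field_derivative_at_within[OF S]])
  have mono: "S x \<le> S y" if "x \<le> y" for x y
    by (rule DERIV_nonneg_imp_nondecreasing[OF that]) (use S tent_nonneg in blast)
  have low: "S t = 0" if "t \<le> 0" for t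
  proof (cases "t = 0")
    case False
    then have "t < 0" using that by simp
    then obtain z where "t < z" "z < 0" "S 0 - S t = (0 - t) * tent z"
      using MVT2[of t 0 S tent] S by blast
    then show ?thesis using tent_zero[of z] by (simp add: S_def)
  qed (simp add: S_def)
  have high: "S t = C" if "1 \<le> t" for t
  proof (cases "t = 1")
    case False
    then have "1 < t" using that by simp
    then obtain z where "1 < z" "z < t" "S t - S 1 = (t - 1) * tent z"
      using MVT2[of 1 t S tent] S by blast
    then show ?thesis using tent_zero[of z] by (simp add: C_def)
  qed (simp add: C_def)
  have "S 0 < S 1"
  proof (rule DERIV_pos_imp_increasing_open[of 0 1 S])
    show "\<exists>y. (S has_real_derivative y) (at x) \<and> 0 < y" if "0 < x" "x < 1" for x
      using S[of x] that by (auto simp: tent_def)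
  qed (use c in auto)
  then have C: "0 < C" using low[of 0] C_def by simp
  have "has_bochner_integral lborel (\<lambda>x. tent x * indicator {0..1} x) (S 1 - S 0)"
    by (rule has_bochner_integral_FTC_Icc_real)
      (use S continuous_tent[of UNIV] in \<open>auto simp: continuous_on_eq_continuous_at\<close>)
  moreover have "tent x * indicator {0..1} x = tent x" for x
    using tent_zero[of x] by (cases "x \<le> 0 \<or> 1 \<le> x") auto
  ultimately have "has_bochner_integral lborel tent C" using low[of 0] C_def by simp
  then have "integrable lborel tent" "integral\<^sup>L lborel tent = C"
    by (auto simp: has_bochner_integral_iff)
  moreover have "0 \<le> S t" for t using mono[of "min 0 t" t] low[of "min 0 t"] by simp
  moreover have "S t \<le> C" for t using mono[of t "max 1 t"] high[of "max 1 t"] by simp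
  ultimately show ?thesis using that[OF S C low high] by blast
qed

text \<open>
After substitution this is the statement that the bumps \<open>r n * tent (r n * (x - c) - d)\<close> concentrate
at \<open>c\<close>.
\<close>

lemma approximate_identity_tent:
  fixes G :: "real \<Rightarrow> real"
  assumes G: "continuous_on UNIV G" "\<And>x. \<bar>G x\<bar> \<le> B"
    and r: "filterlim r at_top sequentially"
    and T: "integrable lborel tent" "integral\<^sup>L lborel tent = C"
  shows "(\<lambda>n. LBINT t. G (c + (t + d) / r n) * tent t) \<longlonglongrightarrow> G c * C"
proof -
  have m: "G \<in> borel_measurable borel" "tent \<in> borel_measurable borel"
    using G(1) continuous_tent by (auto intro: borel_measurable_continuous_onI)
  have "(\<lambda>n. LBINT t. G (c + (t + d) / r n) * tent t) \<longlonglongrightarrow> (LBINT t. G c * tent t)"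
  proof (rule integral_dominated_convergence)
    show "integrable lborel (\<lambda>t. B * tent t)" using T(1) by simp
    show "(\<lambda>t. G c * tent t) \<in> borel_measurable lborel" using m by measurable
    show "(\<lambda>t. G (c + (t + d) / r n) * tent t) \<in> borel_measurable lborel" for n using m by measurable
    show "AE t in lborel. (\<lambda>n. G (c + (t + d) / r n) * tent t) \<longlonglongrightarrow> G c * tent t"
    proof (rule AE_I2)
      fix t
      have "(\<lambda>n. c + (t + d) / r n) \<longlonglongrightarrow> c + 0"
        by (intro tendsto_add tendsto_const real_tendsto_divide_at_top[OF tendsto_const r])
      moreover have "isCont G c" using G(1) by (simp add: continuous_on_eq_continuous_at)
      ultimately have "(\<lambda>n. G (c + (t + d) / r n)) \<longlonglongrightarrow> G c"
        using isCont_tendsto_compose by fastforce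
      then show "(\<lambda>n. G (c + (t + d) / r n) * tent t) \<longlonglongrightarrow> G c * tent t"
        by (intro tendsto_mult tendsto_const)
    qed
    show "AE t in lborel. norm (G (c + (t + d) / r n) * tent t) \<le> B * tent t" for n
    proof (rule AE_I2)
      fix t
      have "\<bar>G (c + (t + d) / r n)\<bar> * tent t \<le> B * tent t"
        by (intro mult_right_mono G(2) tent_nonneg)
      then show "norm (G (c + (t + d) / r n) * tent t) \<le> B * tent t"
        using tent_nonneg[of t] by (simp add: abs_mult)
    qed
  qed
  then show ?thesis using T(2) by simp
qed

text \<open>
For \<open>a < b\<close> the weak derivative is tested with smooth plateaus that rise just after \<open>a\<close> and fall just
before \<open>b\<close>. Their derivatives concentrate at \<open>a\<close> and \<open>b\<close> and so pick out \<open>f a - f b\<close>, while the plateaus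
tend to a multiple of the indicator function of \<open>(a, b)\<close>. The ramps lie strictly inside \<open>(a, b)\<close>, so
that \<open>a = 0\<close> and \<open>b = l\<close> are allowed.
\<close>

lemma sobolev_deriv_imp_primitive_on:
  assumes p: "1 \<le> p" and l: "0 < l" and cf: "continuous_on {0..l} f" and sob: "sobolev_deriv p l f f'"
  shows "primitive_on l f f'"
proof -
  have int: "set_integrable lborel {0<..<l} f'"
    using sob Lp_fun_imp_set_integrable[OF p] unfolding sobolev_deriv_def by blast
  obtain S C where S: "\<And>t. (S has_real_derivative tent t) (at t)" and C: "0 < C"
    and low: "\<And>t. t \<le> 0 \<Longrightarrow> S t = (0::real)" and high: "\<And>t. 1 \<le> t \<Longrightarrow> S t = C"
    and Sb: "\<And>t. 0 \<le> S t" "\<And>t. S t \<le> C"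
    and T: "integrable lborel tent" "integral\<^sup>L lborel tent = C"
    using tent_primitive by blast
  \<comment> \<open>the continuous extension of \<open>f\<close> by constants; it allows integration over the whole line\<close>
  define F where "F x = f (max 0 (min l x))" for x
  have F: "continuous_on UNIV F" unfolding F_def
    by (rule continuous_on_compose2[OF cf]) (use l in \<open>auto intro!: continuous_intros\<close>)
  have "bounded (f ` {0..l})" using cf compact_Icc compact_continuous_image compact_imp_bounded by blast
  then obtain B where B: "\<And>t. t \<in> {0..l} \<Longrightarrow> \<bar>f t\<bar> \<le> B" unfolding bounded_iff by fastforce
  have FB: "\<bar>F x\<bar> \<le> B" for x unfolding F_def using l by (intro B) auto
  have mF: "F \<in> borel_measurable borel" "tent \<in> borel_measurable borel"
    using F continuous_tent by (auto intro: borel_measurable_continuous_onI)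
  have "f b - f a = (LBINT t:{a<..<b}. f' t)" if ab: "0 \<le> a" "a < b" "b \<le> l" for a b
  proof -
    \<comment> \<open>with \<open>r n * (b - a) \<ge> 3\<close> the plateau does not start to fall before it starts to rise, and both ramps lie in \<open>(a, b)\<close>\<close>
    define r where "r n = real n + 3 / (b - a)" for n
    have rpos: "0 < r n" for n unfolding r_def using ab by (simp add: add_nonneg_pos)
    have rba: "3 \<le> r n * (b - a)" for n
    proof -
      have "r n * (b - a) = real n * (b - a) + 3" unfolding r_def using ab by (simp add: field_simps)
      then show ?thesis using ab by simp
    qed
    have rlim: "filterlim r at_top sequentially" unfolding r_def
      using filterlim_tendsto_add_at_top[OF tendsto_const filterlim_real_sequentially, of "3 / (b - a)"]
      by (simp add: add.commute)
    define \<phi> where "\<phi> n x = S (r n * (x - a) - 1) - S (r n * (x - b) + 2)" for n x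
    define \<phi>' where "\<phi>' n x = r n * tent (r n * (x - a) - 1) - r n * tent (r n * (x - b) + 2)" for n x
    have d: "(\<phi> n has_real_derivative \<phi>' n x) (at x)" for n x
    proof -
      have "((\<lambda>x. S (r n * (x - a) - 1)) has_real_derivative tent (r n * (x - a) - 1) * r n) (at x)"
        by (rule DERIV_chain2[OF S]) (auto intro!: derivative_eq_intros)
      moreover have "((\<lambda>x. S (r n * (x - b) + 2)) has_real_derivative tent (r n * (x - b) + 2) * r n) (at x)"
        by (rule DERIV_chain2[OF S]) (auto intro!: derivative_eq_intros)
      ultimately show ?thesis unfolding \<phi>_def \<phi>'_def
        by (auto intro!: derivative_eq_intros)
    qed
    then have deriv: "deriv (\<phi> n) = \<phi>' n" for n by (intro ext DERIV_imp_deriv)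
    have c\<phi>': "continuous_on UNIV (\<phi>' n)" for n unfolding \<phi>'_def
      by (intro continuous_intros continuous_on_compose2[OF continuous_tent[of UNIV]]) auto
    have outside: "\<phi> n x = 0" if "x \<le> a + 1 / r n \<or> b - 1 / r n \<le> x" for n x
      using that
    proof
      assume x: "x \<le> a + 1 / r n"
      have "r n * (x - a) \<le> r n * (1 / r n)" using x rpos[of n] by (intro mult_left_mono) auto
      then have 1: "r n * (x - a) \<le> 1" using rpos[of n] by simp
      have "r n * (x - b) = r n * (x - a) - r n * (b - a)" by (simp add: algebra_simps)
      then have "r n * (x - b) + 2 \<le> 0" using 1 rba[of n] by linarith
      then show ?thesis unfolding \<phi>_def using 1 low by simp
    next
      assume x: "b - 1 / r n \<le> x"
      have "r n * (b - x) \<le> r n * (1 / r n)" using x rpos[of n] by (intro mult_left_mono) auto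
      then have 1: "r n * (b - x) \<le> 1" using rpos[of n] by simp
      have "r n * (x - b) = - (r n * (b - x))" "r n * (x - a) = r n * (b - a) - r n * (b - x)"
        by (simp_all add: algebra_simps)
      then have "1 \<le> r n * (x - b) + 2" "1 \<le> r n * (x - a) - 1" using 1 rba[of n] by linarith+
      then show ?thesis unfolding \<phi>_def using high by simp
    qed
    have test: "test_function l (\<phi> n)" for n
      unfolding test_function_def deriv
    proof (intro conjI allI exI[of _ "{a + 1 / r n .. b - 1 / r n}"] impI)
      show "\<phi> n differentiable at x" for x using d real_differentiable_def by blast
      have "0 < 1 / r n" using rpos[of n] by simp
      then have "0 < a + 1 / r n" "b - 1 / r n < l" using ab by linarith+
      then show "{a + 1 / r n .. b - 1 / r n} \<subseteq> {0<..<l}" by force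
      show "\<phi> n x = 0" if "x \<notin> {a + 1 / r n .. b - 1 / r n}" for x
        by (rule outside) (use that in auto)
    qed (use c\<phi>' in auto)
    have weak: "(LBINT x:{0<..<l}. f x * \<phi>' n x) = - (LBINT x:{0<..<l}. f' x * \<phi> n x)" for n
      using sob test[of n] unfolding sobolev_deriv_def deriv[symmetric] by blast
    have right: "(\<lambda>n. LBINT x:{0<..<l}. f' x * \<phi> n x) \<longlonglongrightarrow> (LBINT x:{0<..<l}. f' x * (C * indicator {a<..<b} x))"
      unfolding set_lebesgue_integral_def
    proof (rule integral_dominated_convergence)
      have mf: "(\<lambda>x. indicator {0<..<l} x *\<^sub>R f' x) \<in> borel_measurable lborel"
        using int unfolding set_integrable_def by auto
      have m\<phi>: "\<phi> n \<in> borel_measurable lborel" for n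
        using DERIV_continuous_on[OF has_field_derivative_at_within[OF d[of n]]]
        by (auto intro: borel_measurable_continuous_onI)
      show "(\<lambda>x. indicator {0<..<l} x *\<^sub>R (f' x * \<phi> n x)) \<in> borel_measurable lborel" for n
        using borel_measurable_times[OF mf m\<phi>[of n]] by (simp add: mult.assoc)
      have mi: "(\<lambda>x. C * indicat_real {a<..<b} x) \<in> borel_measurable lborel" by measurable
      show "(\<lambda>x. indicator {0<..<l} x *\<^sub>R (f' x * (C * indicator {a<..<b} x))) \<in> borel_measurable lborel"
        using borel_measurable_times[OF mf mi] by (simp add: mult.assoc)
      show "integrable lborel (\<lambda>x. C * (indicator {0<..<l} x *\<^sub>R \<bar>f' x\<bar>))"
        using set_integrable_abs[OF int] unfolding set_integrable_def by simp
      show "AE x in lborel. norm (indicator {0<..<l} x *\<^sub>R (f' x * \<phi> n x)) \<le> C * (indicator {0<..<l} x *\<^sub>R \<bar>f' x\<bar>)" for n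
      proof (rule AE_I2)
        fix x
        have "\<bar>\<phi> n x\<bar> \<le> C" unfolding \<phi>_def
          using Sb(1)[of "r n * (x - a) - 1"] Sb(1)[of "r n * (x - b) + 2"]
            Sb(2)[of "r n * (x - a) - 1"] Sb(2)[of "r n * (x - b) + 2"] by linarith
        then have "\<bar>f' x\<bar> * \<bar>\<phi> n x\<bar> \<le> \<bar>f' x\<bar> * C" by (intro mult_left_mono) auto
        then show "norm (indicator {0<..<l} x *\<^sub>R (f' x * \<phi> n x)) \<le> C * (indicator {0<..<l} x *\<^sub>R \<bar>f' x\<bar>)"
          by (auto simp: indicator_def abs_mult mult.commute)
      qed
      show "AE x in lborel. (\<lambda>n. indicator {0<..<l} x *\<^sub>R (f' x * \<phi> n x))
          \<longlonglongrightarrow> indicator {0<..<l} x *\<^sub>R (f' x * (C * indicator {a<..<b} x))"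
      proof (rule AE_I2)
        fix x
        have "(\<lambda>n. \<phi> n x) \<longlonglongrightarrow> C * indicator {a<..<b} x"
        proof (cases "x \<in> {a<..<b}")
          case True
          define e where "e = min (x - a) (b - x)"
          have e: "0 < e" using True unfolding e_def by auto
          have "eventually (\<lambda>n. 2 / e \<le> r n) sequentially"
            using rlim unfolding filterlim_at_top by blast
          then have "eventually (\<lambda>n. \<phi> n x = C) sequentially"
          proof eventually_elim
            case (elim n)
            have "2 \<le> r n * e" using elim e by (simp add: field_simps)
            also have "r n * e \<le> r n * (x - a)" unfolding e_def using rpos[of n] by (intro mult_left_mono) auto
            finally have 1: "2 \<le> r n * (x - a)" .
            have "2 \<le> r n * e" using elim e by (simp add: field_simps)
            also have "r n * e \<le> r n * (b - x)" unfolding e_def using rpos[of n] by (intro mult_left_mono) auto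
            finally have "r n * (x - b) + 2 \<le> 0" by (simp add: algebra_simps)
            then show ?case unfolding \<phi>_def using 1 low high by simp
          qed
          then show ?thesis using True by (simp add: tendsto_eventually)
        next
          case False
          have "\<phi> n x = 0" for n
          proof (rule outside)
            have "0 < 1 / r n" using rpos[of n] by simp
            moreover have "x \<le> a \<or> b \<le> x" using False by auto
            ultimately show "x \<le> a + 1 / r n \<or> b - 1 / r n \<le> x" by linarith
          qed
          then show ?thesis using False by simp
        qed
        then show "(\<lambda>n. indicator {0<..<l} x *\<^sub>R (f' x * \<phi> n x))
          \<longlonglongrightarrow> indicator {0<..<l} x *\<^sub>R (f' x * (C * indicator {a<..<b} x))"
          by (intro tendsto_intros)
      qed
    qed
    have left: "(LBINT x:{0<..<l}. f x * \<phi>' n x)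
      = (LBINT t. F (a + (t + 1) / r n) * tent t) - (LBINT t. F (b + (t + -2) / r n) * tent t)" for n
    proof -
      have shift: "(LBINT x. F x * (r n * tent (r n * (x - c) - d))) = (LBINT t. F (c + (t + d) / r n) * tent t)"
        (is "?L = ?R")
        and shift_int: "integrable lborel (\<lambda>x. F x * (r n * tent (r n * (x - c) - d)))" for c d
      proof -
        have eq: "F (c + d / r n + 1 / r n * t) * (r n * tent (r n * (c + d / r n + 1 / r n * t - c) - d))
            = r n * (F (c + (t + d) / r n) * tent t)" for t
        proof -
          have "c + d / r n + 1 / r n * t = c + (t + d) / r n" by (simp add: add_divide_distrib)
          moreover have "r n * (c + (t + d) / r n - c) - d = t" using rpos[of n] by simp
          ultimately show ?thesis by (simp only: mult.left_commute)
        qed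
        have "?L = \<bar>1 / r n\<bar> *\<^sub>R (LBINT t. F (c + d / r n + 1 / r n * t) * (r n * tent (r n * (c + d / r n + 1 / r n * t - c) - d)))"
          by (rule lborel_integral_real_affine) (use rpos[of n] in auto)
        also have "\<dots> = ?R" unfolding eq using rpos[of n] by simp
        finally show "?L = ?R" .
        have "integrable lborel (\<lambda>t. F (c + (t + d) / r n) * tent t)"
        proof (rule Bochner_Integration.integrable_bound)
          show "integrable lborel (\<lambda>t. B * tent t)" using T(1) by simp
          show "(\<lambda>t. F (c + (t + d) / r n) * tent t) \<in> borel_measurable lborel" using mF by measurable
          show "AE t in lborel. norm (F (c + (t + d) / r n) * tent t) \<le> norm (B * tent t)"
          proof (rule AE_I2)
            fix t
            have "\<bar>F (c + (t + d) / r n)\<bar> * \<bar>tent t\<bar> \<le> \<bar>B\<bar> * \<bar>tent t\<bar>"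
              by (rule mult_right_mono) (use FB[of "c + (t + d) / r n"] in auto)
            then show "norm (F (c + (t + d) / r n) * tent t) \<le> norm (B * tent t)" by (simp add: abs_mult)
          qed
        qed
        then have "integrable lborel (\<lambda>t. r n * (F (c + (t + d) / r n) * tent t))" by simp
        then have "integrable lborel (\<lambda>t. (\<lambda>x. F x * (r n * tent (r n * (x - c) - d))) (c + d / r n + 1 / r n * t))"
          unfolding eq .
        then show "integrable lborel (\<lambda>x. F x * (r n * tent (r n * (x - c) - d)))"
          by (subst (asm) lborel_integrable_real_affine_iff) (use rpos[of n] in auto)
      qed
      have supp: "indicator {0<..<l} x *\<^sub>R (f x * \<phi>' n x)
        = F x * (r n * tent (r n * (x - a) - 1)) - F x * (r n * tent (r n * (x - b) - -2))" for x
      proof (cases "x \<in> {0<..<l}")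
        case True
        then show ?thesis unfolding F_def \<phi>'_def by (simp add: algebra_simps)
      next
        case False
        have i: "0 < 1 / r n" using rpos[of n] by simp
        have "tent (r n * (x - a) - 1) = 0 \<and> tent (r n * (x - b) + 2) = 0"
        proof -
          have eq: "r n * (x - b) = r n * (x - a) - r n * (b - a)" by (simp add: algebra_simps)
          consider "x \<le> a" | "b \<le> x" using False ab by force
          then show ?thesis
          proof cases
            case 1
            then have "r n * (x - a) \<le> 0" using rpos[of n] by (simp add: mult_le_0_iff)
            then show ?thesis using eq rba[of n] by (auto intro!: tent_zero)
          next
            case 2
            then have "0 \<le> r n * (x - b)" using rpos[of n] by simp
            then show ?thesis using eq rba[of n] by (auto intro!: tent_zero)
          qed
        qed
        then show ?thesis using False by simp
      qed
      have "(LBINT x:{0<..<l}. f x * \<phi>' n x) = (LBINT x. F x * (r n * tent (r n * (x - a) - 1)) - F x * (r n * tent (r n * (x - b) - -2)))"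
        unfolding set_lebesgue_integral_def supp ..
      also have "\<dots> = (LBINT x. F x * (r n * tent (r n * (x - a) - 1))) - (LBINT x. F x * (r n * tent (r n * (x - b) - -2)))"
        by (rule Bochner_Integration.integral_diff[OF shift_int shift_int])
      finally show ?thesis unfolding shift .
    qed
    have "(\<lambda>n. LBINT x:{0<..<l}. f x * \<phi>' n x) \<longlonglongrightarrow> F a * C - F b * C"
      unfolding left by (intro tendsto_diff approximate_identity_tent[OF F FB rlim T])
    moreover have "(\<lambda>n. LBINT x:{0<..<l}. f x * \<phi>' n x) \<longlonglongrightarrow> - (LBINT x:{0<..<l}. f' x * (C * indicator {a<..<b} x))"
      unfolding weak by (intro tendsto_minus right)
    ultimately have "F a * C - F b * C = - (LBINT x:{0<..<l}. f' x * (C * indicator {a<..<b} x))"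
      by (rule LIMSEQ_unique)
    moreover have "(LBINT x:{0<..<l}. f' x * (C * indicator {a<..<b} x)) = C * (LBINT x:{a<..<b}. f' x)"
      unfolding set_lebesgue_integral_def integral_mult_right_zero[symmetric]
      by (rule Bochner_Integration.integral_cong) (use ab in \<open>auto simp: indicator_def\<close>)
    moreover have "F a = f a" "F b = f b" unfolding F_def using ab by auto
    ultimately have "f a * C - f b * C = - (C * (LBINT x:{a<..<b}. f' x))" by (simp only:)
    then have "C * (f b - f a) = C * (LBINT x:{a<..<b}. f' x)" by (simp add: right_diff_distrib mult.commute)
    then show ?thesis using C by simp
  qed
  then have "f b - f a = (LBINT t:{a<..<b}. f' t)" if "0 \<le> a" "a \<le> b" "b \<le> l" for a b
    using that by (cases "a = b") (auto simp: set_lebesgue_integral_def)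
  then show ?thesis unfolding primitive_on_def using cf int by blast
qed

section \<open>The constant \<open>pi_p\<close> as an integral\<close>

lemma Gamma_reflection_real:
  "Gamma x * Gamma (1 - x) = pi / sin (pi * x)" for x :: real
proof -
  have "complex_of_real (Gamma x * Gamma (1 - x)) = of_real pi / sin (of_real pi * of_real x)"
    using Gamma_reflection_complex[of "of_real x"]
    by (simp flip: Gamma_complex_of_real)
  also have "\<dots> = complex_of_real (pi / sin (pi * x))"
    by (simp add: sin_of_real[symmetric])
  finally show ?thesis by (simp only: of_real_eq_iff)
qed

text \<open>
The reflection formula of the Gamma function, at \<open>1/p\<close>, is the source of the sine in \<open>pi_p\<close>.
\<close>

lemma Beta_pi_p:
  assumes p: "1 < p"
  shows "Beta (1/p) (2 - 1/p) = (p - 1) * pi_p p / 2"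
proof -
  have "0 < 1 - 1/p" using p by simp
  then have "1 - 1/p \<notin> \<int>\<^sub>\<le>\<^sub>0" by (auto elim!: nonpos_Ints_cases)
  then have "Gamma (2 - 1/p) = (1 - 1/p) * Gamma (1 - 1/p)"
    using Gamma_plus1[of "1 - 1/p"] by simp
  moreover have "Gamma (1/p + (2 - 1/p)) = (1::real)" using Gamma_fact[of 1, where 'a = real] by simp
  ultimately have "Beta (1/p) (2 - 1/p) = (1 - 1/p) * (Gamma (1/p) * Gamma (1 - 1/p))"
    unfolding Beta_def by simp
  also have "\<dots> = (p - 1) * pi_p p / 2"
    unfolding Gamma_reflection_real pi_p_def
    by (cases "sin (pi / p) = 0") (use p in \<open>auto simp: field_simps\<close>)
  finally show ?thesis .
qed

text \<open>
Up to a power of \<open>\<kappa>\<close> this is \<open>A^(p-1)\<close>, where \<open>A\<close> is the slope of a generalized sine with amplitude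
\<open>M\<close> at height \<open>t\<close>. The maximum and the absolute value only extend it continuously beyond \<open>[0, M]\<close>.
\<close>

definition slope_weight :: "real \<Rightarrow> real \<Rightarrow> real \<Rightarrow> real" where
  "slope_weight p M t = (max 0 (M powr p - \<bar>t\<bar> powr p)) powr (1 - 1/p)"

lemma continuous_slope_weight: "1 < p \<Longrightarrow> continuous_on A (slope_weight p M)"
  unfolding slope_weight_def by (intro continuous_intros continuous_on_powr') auto

text \<open>
The substitution \<open>s = (t / M)^p\<close> turns the integral into the Beta integral of \<open>Beta_pi_p\<close>.
\<close>

lemma has_integral_slope_weight:
  assumes p: "1 < p" and M: "0 < M"
  shows "(slope_weight p M has_integral M powr p * ((p - 1) * pi_p p / (2 * p))) {0..M}"
proof -
  define g where "g t = (t / M) powr p" for t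
  define g' where "g' t = p * (t / M) powr (p - 1) / M" for t
  define f where "f s = s powr (1/p - 1) * (1 - s) powr (2 - 1/p - 1)" for s :: real
  have der: "(g has_field_derivative g' t) (at t within {0<..<M})" if "t \<in> {0<..<M}" for t
  proof -
    have "t / M > 0" using that M by simp
    then show ?thesis unfolding g_def g'_def using M
      by (auto intro!: derivative_eq_intros simp: powr_diff field_simps)
  qed
  have inj: "inj_on g {0<..<M}"
  proof (rule inj_onI)
    fix x y assume xy: "x \<in> {0<..<M}" "y \<in> {0<..<M}" "g x = g y"
    then have "((x / M) powr p) powr (1/p) = ((y / M) powr p) powr (1/p)" unfolding g_def by simp
    then show "x = y" using xy p M by (simp add: powr_powr)
  qed
  have img: "g ` {0<..<M} = {0<..<1}"
  proof (intro equalityI subsetI)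
    fix y assume "y \<in> g ` {0<..<M}"
    then obtain t where t: "0 < t" "t < M" "y = (t / M) powr p" unfolding g_def by auto
    then have "(t / M) powr p < 1 powr p" using M p by (intro powr_less_mono2) auto
    then show "y \<in> {0<..<1}" using t M by simp
  next
    fix y :: real assume y: "y \<in> {0<..<1}"
    then have "y powr (1/p) < 1 powr (1/p)" using p by (intro powr_less_mono2) auto
    then have "M * y powr (1/p) \<in> {0<..<M}" using y M by simp
    moreover have "g (M * y powr (1/p)) = y" unfolding g_def using y M p by (simp add: powr_powr)
    ultimately show "y \<in> g ` {0<..<M}" by (metis imageI)
  qed
  have "(f has_integral Beta (1/p) (2 - 1/p)) {0<..<1}"
    unfolding f_def has_integral_Icc_iff_Ioo[symmetric]
    by (rule has_integral_Beta_real) (use p in \<open>auto simp: field_simps\<close>)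
  then have "f absolutely_integrable_on (g ` {0<..<M}) \<and> integral (g ` {0<..<M}) f = (p - 1) * pi_p p / 2"
    unfolding img Beta_pi_p[OF p]
    by (auto simp: f_def has_integral_iff intro!: nonnegative_absolutely_integrable_1)
  then have "(\<lambda>x. \<bar>g' x\<bar> * f (g x)) absolutely_integrable_on {0<..<M} \<and>
      integral {0<..<M} (\<lambda>x. \<bar>g' x\<bar> * f (g x)) = (p - 1) * pi_p p / 2"
    by (subst has_absolute_integral_change_of_variables_1'[OF _ der inj]) auto
  then have "((\<lambda>x. \<bar>g' x\<bar> * f (g x)) has_integral (p - 1) * pi_p p / 2) {0<..<M}"
    using set_lebesgue_integral_eq_integral(1) by (auto simp: has_integral_iff)
  then have "((\<lambda>x. M powr p / p * (\<bar>g' x\<bar> * f (g x))) has_integral M powr p / p * ((p - 1) * pi_p p / 2)) {0<..<M}"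
    by (rule has_integral_mult_right)
  moreover have "M powr p / p * (\<bar>g' t\<bar> * f (g t)) = slope_weight p M t" if t: "t \<in> {0<..<M}" for t
  proof -
    define s where "s = t / M"
    have s: "0 < s" "s < 1" "t = M * s" using t M unfolding s_def by auto
    have "s powr p \<le> 1 powr p" using s p by (intro powr_mono2) auto
    then have sp: "0 \<le> 1 - s powr p" by simp
    have e1: "(s powr p) powr (1/p - 1) * s powr (p - 1) = 1"
      using s p by (simp add: powr_powr powr_add[symmetric] right_diff_distrib)
    have "f (g t) = (s powr p) powr (1/p - 1) * (1 - s powr p) powr (1 - 1/p)"
      unfolding f_def g_def s_def by simp
    moreover have "\<bar>g' t\<bar> = p * s powr (p - 1) / M"
      unfolding g'_def s_def using p M by simp
    ultimately have "M powr p / p * (\<bar>g' t\<bar> * f (g t))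
      = M powr p / M * (1 - s powr p) powr (1 - 1/p) * ((s powr p) powr (1/p - 1) * s powr (p - 1))"
      using p by simp
    also have "\<dots> = M powr (p - 1) * (1 - s powr p) powr (1 - 1/p)"
      unfolding e1 using M by (simp add: powr_diff)
    also have "M powr (p - 1) = (M powr p) powr (1 - 1/p)"
      using p by (simp add: powr_powr right_diff_distrib)
    also have "(M powr p) powr (1 - 1/p) * (1 - s powr p) powr (1 - 1/p) = (M powr p * (1 - s powr p)) powr (1 - 1/p)"
      using sp by (simp add: powr_mult)
    also have "M powr p * (1 - s powr p) = M powr p - t powr p"
      unfolding s(3) using M s by (simp add: powr_mult right_diff_distrib)
    also have "M powr p - t powr p = max 0 (M powr p - \<bar>t\<bar> powr p)"
      using t p by (simp add: powr_mono2)
    finally show ?thesis unfolding slope_weight_def .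
  qed
  ultimately have "(slope_weight p M has_integral M powr p / p * ((p - 1) * pi_p p / 2)) {0<..<M}"
    by (subst (asm) has_integral_cong) auto
  then show ?thesis unfolding has_integral_Icc_iff_Ioo using p by (simp add: field_simps)
qed

lemma slope_weight_primitive:
  assumes p: "1 < p" and M: "0 < M"
  obtains h where "\<And>t. (h has_real_derivative slope_weight p M t) (at t)" "continuous_on UNIV (slope_weight p M)"
    "mono h" "h M - h 0 = M powr p * ((p - 1) * pi_p p / (2 * p))"
proof -
  have c: "continuous_on UNIV (slope_weight p M)" by (rule continuous_slope_weight[OF p])
  obtain h where h: "\<And>t. (h has_real_derivative slope_weight p M t) (at t)"
    using einterval_antiderivative[of "-\<infinity>" "\<infinity>" "slope_weight p M"] c
    by (auto simp: continuous_on_eq_continuous_at has_real_derivative_iff_has_vector_derivative)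
  have "mono h"
  proof (rule monoI)
    fix x y :: real assume "x \<le> y"
    moreover have "\<exists>d. (h has_real_derivative d) (at t) \<and> 0 \<le> d" for t
      using h[of t] by (auto simp: slope_weight_def)
    ultimately show "h x \<le> h y" by (rule DERIV_nonneg_imp_nondecreasing)
  qed
  moreover have "(slope_weight p M has_integral h M - h 0) {0..M}"
    by (rule fundamental_theorem_of_calculus)
      (use M h in \<open>auto simp: has_real_derivative_iff_has_vector_derivative[symmetric] intro: has_field_derivative_at_within\<close>)
  then have "h M - h 0 = M powr p * ((p - 1) * pi_p p / (2 * p))"
    using has_integral_slope_weight[OF p M] has_integral_unique by blast
  ultimately show ?thesis using that[OF h c] by blast
qed

lemma Young_powr:
  fixes y A p :: real
  assumes p: "1 < p" and "0 \<le> y" "0 \<le> A"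
  shows "p * A powr (p - 1) * y \<le> y powr p + (p - 1) * A powr p"
proof -
  have "y * A powr (p - 1) \<le> y powr p / p + (A powr (p - 1)) powr (p / (p - 1)) / (p / (p - 1))"
    by (rule Youngs_inequality) (use assms in \<open>auto simp: field_simps\<close>)
  also have "(A powr (p - 1)) powr (p / (p - 1)) = A powr p" using p by (simp add: powr_powr)
  finally have "p * (y * A powr (p - 1)) \<le> p * (y powr p / p + A powr p / (p / (p - 1)))"
    using p by simp
  also have "\<dots> = y powr p + (p - 1) * A powr p" using p by (simp add: field_simps)
  finally show ?thesis by (simp add: ac_simps)
qed

section \<open>Edge cuts\<close>

context metric_graph
begin

text \<open>
Without the edges that join \<open>S\<close> to its complement, a walk that starts in \<open>S\<close> stays in \<open>S\<close>.
\<close>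

lemma edge_connectivity_le_cut:
  assumes "x \<in> verts G" "y \<in> verts G" "x \<in> S" "y \<notin> S"
  shows "edge_connectivity G \<le> card {e \<in> arcs G. (tail G e \<in> S) \<noteq> (head G e \<in> S)}"
proof -
  let ?F = "{e \<in> arcs G. (tail G e \<in> S) \<noteq> (head G e \<in> S)}"
  let ?H = "G\<lparr>arcs := arcs G - ?F\<rparr>"
  have "card {x, y} \<le> card (verts G)" using assms by (intro card_mono) auto
  then have card: "1 < card (verts G)" using assms by (auto simp: card_insert_if split: if_splits)
  have "\<not> Digraph_Component.connected ?H"
  proof
    assume "Digraph_Component.connected ?H"
    then have "x \<rightarrow>\<^sup>*\<^bsub>with_proj (mk_symmetric ?H)\<^esub> y"
      unfolding connected_def strongly_connected_def using assms by simp
    then have "(x, y) \<in> (parcs (mk_symmetric ?H))\<^sup>*" using reachable_rtranclI by fastforce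
    then have "y \<in> S"
    proof (induction rule: rtrancl_induct)
      case base
      then show ?case using assms(3) .
    next
      case (step a b)
      then obtain e where "e \<in> arcs G" "e \<notin> ?F" "(a, b) = (tail G e, head G e) \<or> (a, b) = (head G e, tail G e)"
        unfolding parcs_mk_symmetric by auto
      then show ?case using step.IH by auto
    qed
    then show False using assms(4) by simp
  qed
  then have "\<exists>F\<subseteq>arcs G. card F = card ?F \<and> \<not> Digraph_Component.connected (G\<lparr>arcs := arcs G - F\<rparr>)"
    by (intro exI[of _ ?F]) auto
  then show ?thesis unfolding edge_connectivity_def using card by (simp add: Least_le)
qed

text \<open>
This is a discrete coarea formula: the sum on the right is the integral over all levels \<open>t\<close> of the
number of edges that cross \<open>t\<close>, and for \<open>g y \<le> t < g x\<close> these edges form a cut between \<open>x\<close> and \<open>y\<close>.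
\<close>

lemma edge_connectivity_mult_oscillation_le:
  fixes g :: "'v \<Rightarrow> real"
  assumes x: "x \<in> verts G" and y: "y \<in> verts G"
  shows "real (edge_connectivity G) * (g x - g y) \<le> (\<Sum>e\<in>arcs G. \<bar>g (tail G e) - g (head G e)\<bar>)"
proof (cases "g y < g x")
  case False
  then have "real (edge_connectivity G) * (g x - g y) \<le> 0" by (simp add: mult_nonneg_nonpos)
  also have "0 \<le> (\<Sum>e\<in>arcs G. \<bar>g (tail G e) - g (head G e)\<bar>)" by (intro sum_nonneg) simp
  finally show ?thesis .
next
  case True
  define I where "I e = {min (g (tail G e)) (g (head G e)) ..< max (g (tail G e)) (g (head G e))}" for e
  have fin: "emeasure lborel {a..<b} \<noteq> \<infinity>" for a b :: real
    by (cases "a \<le> b") auto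
  have meas: "measure lborel {a..<b} = b - a" if "a \<le> b" for a b :: real
    using that by (simp add: measure_def)
  have int: "integrable lborel (\<lambda>t. indicat_real {a..<b} t)" for a b :: real
    using fin[of a b] by (simp add: top.not_eq_extremum)
  have "real (edge_connectivity G) * (g x - g y) = (LBINT t. real (edge_connectivity G) * indicator {g y..<g x} t)"
    using True meas[of "g y" "g x"] by simp
  also have "\<dots> \<le> (LBINT t. \<Sum>e\<in>arcs G. indicator (I e) t)"
  proof (rule integral_mono)
    show "integrable lborel (\<lambda>t. real (edge_connectivity G) * indicat_real {g y..<g x} t)"
      using int by simp
    show "integrable lborel (\<lambda>t. \<Sum>e\<in>arcs G. indicat_real (I e) t)" unfolding I_def
      by (intro Bochner_Integration.integrable_sum int)
    fix t
    show "real (edge_connectivity G) * indicat_real {g y..<g x} t \<le> (\<Sum>e\<in>arcs G. indicat_real (I e) t)"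
    proof (cases "t \<in> {g y..<g x}")
      case True
      let ?S = "{v. t < g v}"
      have "edge_connectivity G \<le> card {e \<in> arcs G. (tail G e \<in> ?S) \<noteq> (head G e \<in> ?S)}"
        by (rule edge_connectivity_le_cut[OF x y]) (use True in auto)
      also have "{e \<in> arcs G. (tail G e \<in> ?S) \<noteq> (head G e \<in> ?S)} = {e \<in> arcs G. t \<in> I e}"
        unfolding I_def by (auto simp: min_def max_def)
      finally have "real (edge_connectivity G) \<le> real (card {e \<in> arcs G. t \<in> I e})" by simp
      also have "\<dots> = (\<Sum>e\<in>arcs G. indicat_real (I e) t)"
        by (simp add: indicator_def sum.If_cases Int_def)
      finally show ?thesis using True by simp
    next
      case False
      then show ?thesis by (simp add: sum_nonneg)
    qed
  qed
  also have "\<dots> = (\<Sum>e\<in>arcs G. LBINT t. indicator (I e) t)" unfolding I_def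
    by (intro Bochner_Integration.integral_sum int)
  also have "\<dots> = (\<Sum>e\<in>arcs G. \<bar>g (tail G e) - g (head G e)\<bar>)"
    unfolding I_def by (intro sum.cong refl) (auto simp: meas min_def max_def)
  finally show ?thesis .
qed

end

section \<open>The estimate on a single edge\<close>

text \<open>
The part of the variation of \<open>H \<circ> f\<close> that is due to levels between \<open>lo\<close> and \<open>hi\<close> is the variation of \<open>H\<close>
after \<open>f\<close> has been truncated to \<open>[lo, hi]\<close>. Splitting it in this way makes it possible to count the
crossings differently in different ranges of levels.
\<close>

lemma band_variation:
  fixes f g H k :: "real \<Rightarrow> real"
  assumes f: "primitive_on l f g"
    and H: "\<And>t. (H has_real_derivative k t) (at t)" and k: "continuous_on UNIV k" "\<And>t. 0 \<le> k t"
    and lohi: "lo \<le> hi"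
  shows "set_integrable lborel {0<..<l} (\<lambda>t. if lo < f t \<and> f t \<le> hi then k (f t) * \<bar>g t\<bar> else 0)"
    and "0 \<le> x \<Longrightarrow> x \<le> y \<Longrightarrow> y \<le> l \<Longrightarrow>
      \<bar>H (max lo (min hi (f y))) - H (max lo (min hi (f x)))\<bar>
        \<le> (LBINT t:{x<..<y}. if lo < f t \<and> f t \<le> hi then k (f t) * \<bar>g t\<bar> else 0)"
proof -
  let ?v = "\<lambda>t. if lo < f t \<and> f t \<le> hi then k (f t) * \<bar>g t\<bar> else 0"
  let ?w = "\<lambda>t. max lo (min hi (f t))"
  let ?d = "\<lambda>t. if lo < f t \<and> f t \<le> hi then g t else 0"
  have "primitive_on l ?w ?d"
    by (rule primitive_on_cong[OF primitive_on_add[OF primitive_on_const[of _ lo] primitive_on_add[OF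
          primitive_on_pos_part[OF f, of lo] primitive_on_cmult[OF primitive_on_pos_part[OF f, of hi], of "-1"]]]])
      (use lohi in auto)
  from primitive_on_compose_C1[OF this H k(1)]
  have P: "primitive_on l (\<lambda>t. H (?w t)) (\<lambda>t. k (?w t) * ?d t)" .
  have abs: "\<bar>k (?w t) * ?d t\<bar> = ?v t" for t
    using k(2)[of "f t"] by (simp add: abs_mult)
  show "set_integrable lborel {0<..<l} ?v"
    using set_integrable_abs[OF primitive_onD(2)[OF P]] unfolding abs .
  assume xy: "0 \<le> x" "x \<le> y" "y \<le> l"
  have "\<bar>H (?w y) - H (?w x)\<bar> = norm (LBINT t:{x<..<y}. k (?w t) * ?d t)"
    using primitive_onD(3)[OF P xy] by simp
  also have "\<dots> \<le> (LBINT t:{x<..<y}. norm (k (?w t) * ?d t))"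
    by (rule set_integral_norm_bound[OF primitive_onD(4)[OF P xy]])
  finally show "\<bar>H (?w y) - H (?w x)\<bar> \<le> (LBINT t:{x<..<y}. ?v t)" unfolding real_norm_def abs .
qed

text \<open>
Below the height \<open>b\<close> the test function is the positive part of \<open>f\<close>, above \<open>b\<close> it has slope \<open>1 + c\<close> as a
function of \<open>f\<close>. The slope may differ from edge to edge, since vertex values do not exceed \<open>b\<close>.
\<close>

lemma test_sobolev_deriv:
  fixes b c :: real
  assumes l: "0 < l" and p: "0 < p" and f: "primitive_on l f g" and g: "Lp_fun p l g"
  defines "s \<equiv> \<lambda>x. (if f x > 0 then 1 else 0) + c * (if f x > b then 1 else 0 :: real)"
  shows "sobolev_deriv p l (\<lambda>x. max (f x) 0 + c * max (f x - b) 0) (\<lambda>x. s x * g x)"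
proof (rule primitive_on_imp_sobolev_deriv[OF l p])
  show P: "primitive_on l (\<lambda>x. max (f x) 0 + c * max (f x - b) 0) (\<lambda>x. s x * g x)"
    by (rule primitive_on_cong[OF primitive_on_add[OF primitive_on_pos_part[OF f, of 0]
          primitive_on_cmult[OF primitive_on_pos_part[OF f, of b], of c]]])
      (auto simp: s_def algebra_simps)
  have m: "set_borel_measurable lborel {0<..<l} (\<lambda>x. s x * g x)"
    using primitive_onD(2)[OF P] unfolding set_integrable_def set_borel_measurable_def by simp
  have "set_integrable lborel {0<..<l} (\<lambda>x. \<bar>s x * g x\<bar> powr p)"
  proof (rule set_integrable_bound)
    show "set_integrable lborel {0<..<l} (\<lambda>x. (1 + \<bar>c\<bar>) powr p * \<bar>g x\<bar> powr p)"
      using g unfolding Lp_fun_def by simp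
    have "(\<lambda>x. \<bar>indicator {0<..<l} x *\<^sub>R (s x * g x)\<bar> powr p) \<in> borel_measurable lborel"
      using m unfolding set_borel_measurable_def by measurable
    also have "(\<lambda>x. \<bar>indicator {0<..<l} x *\<^sub>R (s x * g x)\<bar> powr p)
       = (\<lambda>x. indicator {0<..<l} x *\<^sub>R (\<bar>s x * g x\<bar> powr p))"
      by (auto simp: indicator_def fun_eq_iff)
    finally show "set_borel_measurable lborel {0<..<l} (\<lambda>x. \<bar>s x * g x\<bar> powr p)"
      unfolding set_borel_measurable_def .
    show "AE x in lborel. x \<in> {0<..<l} \<longrightarrow> norm (\<bar>s x * g x\<bar> powr p) \<le> norm ((1 + \<bar>c\<bar>) powr p * \<bar>g x\<bar> powr p)"
    proof (intro AE_I2 impI)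
      fix x
      have "\<bar>s x\<bar> \<le> 1 + \<bar>c\<bar>" unfolding s_def by auto
      then have "\<bar>s x\<bar> * \<bar>g x\<bar> \<le> (1 + \<bar>c\<bar>) * \<bar>g x\<bar>" by (intro mult_right_mono) auto
      then have "\<bar>s x * g x\<bar> powr p \<le> ((1 + \<bar>c\<bar>) * \<bar>g x\<bar>) powr p"
        using p by (intro powr_mono2) (auto simp: abs_mult)
      then show "norm (\<bar>s x * g x\<bar> powr p) \<le> norm ((1 + \<bar>c\<bar>) powr p * \<bar>g x\<bar> powr p)"
        by (simp add: powr_mult)
    qed
  qed
  with m show "Lp_fun p l (\<lambda>x. s x * g x)" unfolding Lp_fun_def by simp
qed

text \<open>
Equality holds for \<open>y^p = \<kappa> (M^p - t^p)\<close>, the equation that the generalized sine satisfies.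
\<close>

lemma Young_slope_weight:
  assumes p: "1 < p" and \<kappa>: "0 \<le> \<kappa>" and t: "0 \<le> t" "t \<le> M" and y: "0 \<le> y"
  shows "p * \<kappa> powr (1 - 1/p) * slope_weight p M t * y \<le> y powr p + (p - 1) * \<kappa> * (M powr p - t powr p)"
proof -
  define A where "A = (\<kappa> * (M powr p - t powr p)) powr (1/p)"
  have d: "0 \<le> M powr p - t powr p" using t p by (simp add: powr_mono2)
  have "p * A powr (p - 1) * y \<le> y powr p + (p - 1) * A powr p"
    by (rule Young_powr[OF p y]) (simp add: A_def)
  moreover have "A powr p = \<kappa> * (M powr p - t powr p)"
    unfolding A_def using p \<kappa> d by (simp add: powr_powr)
  moreover have "A powr (p - 1) = \<kappa> powr (1 - 1/p) * slope_weight p M t"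
  proof -
    have "A powr (p - 1) = (\<kappa> * (M powr p - t powr p)) powr (1 - 1/p)"
      unfolding A_def using p by (simp add: powr_powr diff_divide_distrib)
    then show ?thesis unfolding slope_weight_def using t d \<kappa> by (simp add: powr_mult)
  qed
  ultimately show ?thesis by (simp add: ac_simps)
qed

lemma powr_minus_two_mult:
  fixes z r p :: real
  shows "\<bar>z\<bar> powr (p - 2) * z * (r * z) = r * \<bar>z\<bar> powr p"
proof (cases "z = 0")
  case False
  have "\<bar>z\<bar> powr (p - 2) * \<bar>z\<bar> powr 2 = \<bar>z\<bar> powr p" by (simp only: powr_add[symmetric]) simp
  moreover have "\<bar>z\<bar> powr 2 = z * z" using False by (simp add: power2_eq_square)
  ultimately show ?thesis by (simp add: ac_simps)
qed simp

text \<open>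
The calibration at a single point, with \<open>t = \<psi>\<close> and \<open>y = \<psi>'\<close>. For \<open>0 < t \<le> b\<close> the powers of \<open>t\<close> cancel
and \<open>\<mu> M^p\<close> remains. For \<open>t > b\<close> the test function is \<open>(1 + c) t - c b\<close>. If \<open>c\<close> is nonnegative, the
term with \<open>c b\<close> has the right sign and is dropped; if \<open>c\<close> is negative, it is controlled by
\<open>t^(p-1) b \<le> M^p\<close>.
\<close>

lemma test_integrand_bound:
  fixes t y b c M \<kappa> p :: real
  assumes p: "1 < p" and \<kappa>: "0 < \<kappa>" and t: "t \<le> M" and b: "0 \<le> b" "b \<le> M" and c: "-1 \<le> c"
  defines "\<mu> \<equiv> (p - 1) * \<kappa>"
  defines "s \<equiv> (if t > 0 then 1 else 0) + c * (if t > b then 1 else 0)"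
  shows "p * \<kappa> powr (1 - 1/p) * (s * (slope_weight p M t * \<bar>y\<bar>)) - \<mu> * M powr p * ((if t > 0 then 1 else 0) + max c 0)
    \<le> \<bar>y\<bar> powr (p - 2) * y * (s * y) - \<mu> * (\<bar>t\<bar> powr (p - 2) * t * (max t 0 + c * max (t - b) 0))"
proof -
  have \<mu>: "0 < \<mu>" unfolding \<mu>_def using p \<kappa> by simp
  define E where "E = p * \<kappa> powr (1 - 1/p) * slope_weight p M t * \<bar>y\<bar>"
  define Y where "Y = \<bar>y\<bar> powr p"
  have lhs: "p * \<kappa> powr (1 - 1/p) * (s * (slope_weight p M t * \<bar>y\<bar>)) = s * E"
    unfolding E_def by (simp add: ac_simps)
  have rhs: "\<bar>y\<bar> powr (p - 2) * y * (s * y) = s * Y"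
    unfolding Y_def by (rule powr_minus_two_mult)
  have Mp: "0 \<le> M powr p" by simp
  show ?thesis
  proof (cases "t > 0")
    case False
    then have z: "s = 0" "max t 0 + c * max (t - b) 0 = 0" unfolding s_def using b by auto
    have "0 \<le> \<mu> * M powr p * max c 0" using \<mu> Mp by simp
    then show ?thesis unfolding lhs rhs z using False by simp
  next
    case True
    have Y: "E \<le> Y + \<mu> * (M powr p - t powr p)"
      unfolding E_def Y_def \<mu>_def
      using Young_slope_weight[OF p, of \<kappa> t M "\<bar>y\<bar>"] \<kappa> t True by (simp add: ac_simps)
    define r where "r = t powr (p - 1)"
    have rt: "\<bar>t\<bar> powr (p - 2) * t = r" "r * t = t powr p"
    proof -
      show "\<bar>t\<bar> powr (p - 2) * t = r" unfolding r_def using True powr_add[of t "p - 2" 1] by simp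
      show "r * t = t powr p" unfolding r_def using True powr_add[of t "p - 1" 1] by simp
    qed
    have tp: "t powr p \<le> M powr p" using True t p by (intro powr_mono2) auto
    show ?thesis
    proof (cases "t > b")
      case False
      then have z: "s = 1" "max t 0 + c * max (t - b) 0 = t" unfolding s_def using True by auto
      have "0 \<le> \<mu> * M powr p * max c 0" using \<mu> Mp by simp
      then show ?thesis unfolding lhs rhs unfolding rt z using Y True by (simp add: algebra_simps)
    next
      case tb: True
      have s: "s = 1 + c" "max t 0 + c * max (t - b) 0 = t + c * (t - b)" unfolding s_def using True tb by auto
      have rb: "r * b \<le> M powr p" "0 \<le> r * b"
      proof -
        have "r * b \<le> r * t" using tb unfolding r_def by (intro mult_left_mono) auto
        then show "r * b \<le> M powr p" using rt(2) tp by simp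
        show "0 \<le> r * b" using b unfolding r_def by simp
      qed
      have "(1 + c) * E \<le> (1 + c) * (Y + \<mu> * (M powr p - t powr p))"
        using Y c by (intro mult_left_mono) auto
      then have 1: "(1 + c) * E \<le> (1 + c) * Y + \<mu> * ((1 + c) * M powr p) - \<mu> * ((1 + c) * t powr p)"
        by (simp add: algebra_simps)
      have "c * M powr p - c * (r * b) \<le> max c 0 * M powr p"
      proof (cases "0 \<le> c")
        case True
        then show ?thesis using rb(2) by simp
      next
        case False
        then have "c * M powr p \<le> c * (r * b)" using rb(1) by (intro mult_left_mono_neg) auto
        then show ?thesis using False by simp
      qed
      then have "\<mu> * (c * M powr p - c * (r * b)) \<le> \<mu> * (max c 0 * M powr p)" using \<mu> by simp
      then have 2: "\<mu> * ((1 + c) * M powr p) \<le> \<mu> * M powr p * (1 + max c 0) + \<mu> * (c * (r * b))"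
        by (simp add: algebra_simps)
      have 3: "r * (t + c * (t - b)) = (1 + c) * t powr p - c * (r * b)"
        unfolding rt(2)[symmetric] by (simp add: algebra_simps)
      show ?thesis unfolding lhs rhs unfolding rt s unfolding 3 using 1 2 True by (simp add: right_diff_distrib)
    qed
  qed
qed

lemma superlevel_measurable:
  fixes f :: "real \<Rightarrow> real"
  assumes "continuous_on {0..l} f"
  shows "{x \<in> {0<..<l}. a < f x} \<in> sets lborel"
proof -
  have "open ({0<..<l} \<inter> f -` {a<..})"
    by (rule continuous_open_preimage[OF continuous_on_subset[OF assms]]) auto
  moreover have "{0<..<l} \<inter> f -` {a<..} = {x \<in> {0<..<l}. a < f x}" by auto
  ultimately show ?thesis by simp
qed

lemma set_integrable_superlevel:
  fixes f w :: "real \<Rightarrow> real"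
  assumes "continuous_on {0..l} f" "set_integrable lborel {0<..<l} w"
  shows "set_integrable lborel {0<..<l} (\<lambda>x. if a < f x then w x else 0)"
proof -
  have "set_integrable lborel {x \<in> {0<..<l}. a < f x} w"
    by (rule set_integrable_subset[OF assms(2) superlevel_measurable[OF assms(1)]]) auto
  moreover have "indicator {x \<in> {0<..<l}. a < f x} x *\<^sub>R w x = indicator {0<..<l} x *\<^sub>R (if a < f x then w x else 0)" for x
    by (auto simp: indicator_def)
  ultimately show ?thesis unfolding set_integrable_def by simp
qed

text \<open>
The right-hand side is the contribution of one edge to the eigenvalue equation, tested with the
function of \<open>test_sobolev_deriv\<close>. Summed over all edges it vanishes for an eigenfunction.
\<close>

lemma edge_energy_bound:
  fixes f g :: "real \<Rightarrow> real" and p \<kappa> l M b c :: real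
  assumes p: "1 < p" and \<kappa>: "0 < \<kappa>" and l: "0 < l" and P: "primitive_on l f g" and g: "Lp_fun p l g"
    and M: "\<And>x. x \<in> {0..l} \<Longrightarrow> f x \<le> M" and b: "0 \<le> b" "b \<le> M" and c: "-1 \<le> c"
  defines "\<mu> \<equiv> (p - 1) * \<kappa>"
  defines "s \<equiv> \<lambda>x. (if f x > 0 then 1 else 0) + c * (if f x > b then 1 else 0)"
  shows "p * \<kappa> powr (1 - 1/p) * (LBINT x:{0<..<l}. s x * (slope_weight p M (f x) * \<bar>g x\<bar>))
      - \<mu> * M powr p * (measure lborel {x \<in> {0<..<l}. 0 < f x} + max c 0 * l)
    \<le> (LBINT x:{0<..<l}. \<bar>g x\<bar> powr (p - 2) * g x * (s x * g x))
      - \<mu> * (LBINT x:{0<..<l}. \<bar>f x\<bar> powr (p - 2) * f x * (max (f x) 0 + c * max (f x - b) 0))"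
proof -
  note fD = primitive_onD[OF P]
  let ?I = "\<lambda>w. (LBINT x:{0<..<l}. w x)"
  let ?U = "{x \<in> {0<..<l}. 0 < f x}"
  have s_int: "set_integrable lborel {0<..<l} (\<lambda>x. s x * w x)" if "set_integrable lborel {0<..<l} w" for w
  proof -
    have "set_integrable lborel {0<..<l} (\<lambda>x. (if 0 < f x then w x else 0) + c * (if b < f x then w x else 0))"
      by (intro set_integral_add(1) set_integrable_superlevel[OF fD(1) that]
          set_integrable_mult_right set_integrable_superlevel[OF fD(1) that]) 
    moreover have "(\<lambda>x. (if 0 < f x then w x else 0) + c * (if b < f x then w x else 0)) = (\<lambda>x. s x * w x)"
      unfolding s_def by (auto simp: fun_eq_iff algebra_simps)
    ultimately show ?thesis by simp
  qed
  have i1: "set_integrable lborel {0<..<l} (\<lambda>x. \<bar>g x\<bar> powr (p - 2) * g x * (s x * g x))"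
    unfolding powr_minus_two_mult by (rule s_int) (use g in \<open>simp add: Lp_fun_def\<close>)
  have i2: "set_integrable lborel {0<..<l} (\<lambda>x. \<bar>f x\<bar> powr (p - 2) * f x * (max (f x) 0 + c * max (f x - b) 0))"
  proof -
    have "continuous_on {0..l} (\<lambda>x. max (f x) 0 powr (p - 1) * (max (f x) 0 + c * max (f x - b) 0))"
      by (intro continuous_intros continuous_on_powr' fD(1)) (use p in auto)
    then have "set_integrable lborel {0<..<l} (\<lambda>x. max (f x) 0 powr (p - 1) * (max (f x) 0 + c * max (f x - b) 0))"
      by (rule set_integrable_subset[OF borel_integrable_atLeastAtMost']) auto
    moreover have "max t 0 powr (p - 1) * (max t 0 + c * max (t - b) 0)
        = \<bar>t\<bar> powr (p - 2) * t * (max t 0 + c * max (t - b) 0)" for t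
    proof (cases "0 < t")
      case True
      then have "t powr (p - 1) = t powr (p - 2) * t" using powr_add[of t "p - 2" 1] by simp
      then show ?thesis using True by simp
    next
      case False
      then show ?thesis using b by simp
    qed
    ultimately show ?thesis by simp
  qed
  have i3: "set_integrable lborel {0<..<l} (\<lambda>x. s x * (slope_weight p M (f x) * \<bar>g x\<bar>))"
    by (rule s_int, rule continuous_mult_set_integrable)
      (use continuous_on_compose2[OF continuous_slope_weight[OF p, of UNIV M] fD(1)] set_integrable_abs[OF fD(2)] in auto)
  have one: "set_integrable lborel {0<..<l} (\<lambda>x. r)" for r :: real
    by (rule set_integrable_subset[OF borel_integrable_atLeastAtMost'[of 0 l]]) auto
  have i4: "set_integrable lborel {0<..<l} (\<lambda>x. (if 0 < f x then 1 else 0) + max c 0)"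
    by (intro set_integral_add(1) set_integrable_superlevel[OF fD(1)] one)
  have I4: "?I (\<lambda>x. (if 0 < f x then 1 else 0) + max c 0) = measure lborel ?U + max c 0 * l"
  proof -
    have "?I (\<lambda>x. (if 0 < f x then 1 else 0) + max c 0) = ?I (\<lambda>x. if 0 < f x then 1 else 0) + ?I (\<lambda>x. max c 0)"
      by (intro set_integral_add(2) set_integrable_superlevel[OF fD(1)] one)
    also have "?I (\<lambda>x. if 0 < f x then 1 else 0) = (LBINT x. indicator ?U x)"
      unfolding set_lebesgue_integral_def by (intro Bochner_Integration.integral_cong) (auto simp: indicator_def)
    also have "\<dots> = measure lborel ?U" using superlevel_measurable[OF fD(1)] by simp
    also have "?I (\<lambda>x. max c 0) = max c 0 * l" using l by (simp add: set_integral_const)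
    finally show ?thesis .
  qed
  have "p * \<kappa> powr (1 - 1/p) * ?I (\<lambda>x. s x * (slope_weight p M (f x) * \<bar>g x\<bar>))
      - \<mu> * M powr p * (measure lborel ?U + max c 0 * l)
    = ?I (\<lambda>x. p * \<kappa> powr (1 - 1/p) * (s x * (slope_weight p M (f x) * \<bar>g x\<bar>))
        - \<mu> * M powr p * ((if 0 < f x then 1 else 0) + max c 0))"
    unfolding I4[symmetric] using i3 i4
    by (subst set_integral_diff(2)) (auto intro: set_integrable_mult_right)
  also have "\<dots> \<le> ?I (\<lambda>x. \<bar>g x\<bar> powr (p - 2) * g x * (s x * g x)
      - \<mu> * (\<bar>f x\<bar> powr (p - 2) * f x * (max (f x) 0 + c * max (f x - b) 0)))"
  proof (rule set_integral_mono)
    fix x assume "x \<in> {0<..<l}"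
    then have "f x \<le> M" using M by auto
    then show "p * \<kappa> powr (1 - 1/p) * (s x * (slope_weight p M (f x) * \<bar>g x\<bar>))
        - \<mu> * M powr p * ((if 0 < f x then 1 else 0) + max c 0)
      \<le> \<bar>g x\<bar> powr (p - 2) * g x * (s x * g x)
      - \<mu> * (\<bar>f x\<bar> powr (p - 2) * f x * (max (f x) 0 + c * max (f x - b) 0))"
      unfolding s_def \<mu>_def by (rule test_integrand_bound[OF p \<kappa> _ b c])
  qed (intro set_integral_diff(1) set_integrable_mult_right i1 i2 i3 i4)+
  also have "\<dots> = ?I (\<lambda>x. \<bar>g x\<bar> powr (p - 2) * g x * (s x * g x))
      - \<mu> * ?I (\<lambda>x. \<bar>f x\<bar> powr (p - 2) * f x * (max (f x) 0 + c * max (f x - b) 0))"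
    using i1 i2 by (subst set_integral_diff(2)) (auto intro: set_integrable_mult_right)
  finally show ?thesis .
qed

section \<open>The length estimate for an eigenfunction\<close>

text \<open>
The weak derivative is an explicit parameter, and the zero function is admitted.
\<close>

definition weak_eigenfunction ::
  "('v, 'e) pre_digraph \<Rightarrow> ('e \<Rightarrow> real) \<Rightarrow> real \<Rightarrow> real \<Rightarrow> ('e \<Rightarrow> real \<Rightarrow> real) \<Rightarrow> ('e \<Rightarrow> real \<Rightarrow> real) \<Rightarrow> bool"
  where
  "weak_eigenfunction G len p \<mu> \<psi> \<psi>' \<longleftrightarrow> W1p_graph G len p \<psi> \<psi>' \<and>
     (\<forall>u u'. W1p_graph G len p u u' \<longrightarrow>
        graph_integral G len (\<lambda>e x. \<bar>\<psi>' e x\<bar> powr (p - 2) * \<psi>' e x * u' e x) =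
        \<mu> * graph_integral G len (\<lambda>e x. \<bar>\<psi> e x\<bar> powr (p - 2) * \<psi> e x * u e x))"

definition positive_length ::
  "('v, 'e) pre_digraph \<Rightarrow> ('e \<Rightarrow> real) \<Rightarrow> ('e \<Rightarrow> real \<Rightarrow> real) \<Rightarrow> real" where
  "positive_length G len \<psi> = (\<Sum>e\<in>arcs G. measure lborel {x \<in> {0<..<len e}. 0 < \<psi> e x})"

context metric_graph
begin

lemma W1p_graph_primitive_on:
  assumes "1 < p" "W1p_graph G len p \<psi> \<psi>'" "e \<in> arcs G"
  shows "primitive_on (len e) (\<psi> e) (\<psi>' e)" "Lp_fun p (len e) (\<psi>' e)"
  using assms len_pos sobolev_deriv_imp_primitive_on[of p "len e" "\<psi> e" "\<psi>' e"]
  by (auto simp: W1p_graph_def continuous_on_graph_def sobolev_deriv_def)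

lemma attains_max:
  assumes "\<And>e. e \<in> arcs G \<Longrightarrow> continuous_on {0..len e} (\<psi> e)"
  obtains e x where "e \<in> arcs G" "x \<in> {0..len e}"
    "\<And>e' x'. e' \<in> arcs G \<Longrightarrow> x' \<in> {0..len e'} \<Longrightarrow> \<psi> e' x' \<le> (\<psi> e x :: real)"
proof -
  have "\<exists>x\<in>{0..len e}. \<forall>x'\<in>{0..len e}. \<psi> e x' \<le> \<psi> e x" if "e \<in> arcs G" for e
    by (rule continuous_attains_sup) (use assms that len_pos[OF that] in auto)
  then obtain X where X: "\<And>e. e \<in> arcs G \<Longrightarrow> X e \<in> {0..len e}"
    "\<And>e x'. e \<in> arcs G \<Longrightarrow> x' \<in> {0..len e} \<Longrightarrow> \<psi> e x' \<le> \<psi> e (X e)" by metis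
  have fin: "finite ((\<lambda>e. \<psi> e (X e)) ` arcs G)" by simp
  have "Max ((\<lambda>e. \<psi> e (X e)) ` arcs G) \<in> (\<lambda>e. \<psi> e (X e)) ` arcs G"
    using arcs_nonempty by (intro Max_in fin) simp
  then obtain e where e: "e \<in> arcs G" "\<psi> e (X e) = Max ((\<lambda>e. \<psi> e (X e)) ` arcs G)" by auto
  have "\<psi> e' x' \<le> \<psi> e (X e)" if "e' \<in> arcs G" "x' \<in> {0..len e'}" for e' x'
  proof -
    have "\<psi> e' x' \<le> \<psi> e' (X e')" using X that by blast
    also have "\<dots> \<le> Max ((\<lambda>e. \<psi> e (X e)) ` arcs G)" using that by (intro Max_ge fin) simp
    finally show ?thesis using e by simp
  qed
  then show ?thesis using that e X by blast
qed

text \<open>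
The levels are split at \<open>q\<close> and \<open>b\<close>, the truncations at \<open>0\<close> of the smallest and of the largest vertex
value. Between \<open>q\<close> and \<open>b\<close> every level is crossed by a cut; the alternative in the assumption on cuts
is the case \<open>q = b = 0\<close>, where there is no such level. Between \<open>0\<close> and \<open>q\<close> the edge with the nonpositive
value is crossed twice, which is enough since \<open>q > 0\<close> forces \<open>m = 2\<close>. Above \<open>b\<close> the edge \<open>es\<close> with the
maximum is crossed twice, and the slope \<open>m/2\<close> of the test function raises this to \<open>m\<close>.
\<close>

lemma superlevel_length_estimate:
  assumes p: "1 < p" and \<mu>: "0 < \<mu>" and eig: "weak_eigenfunction G len p \<mu> \<psi> \<psi>'"
    and pos: "e1 \<in> arcs G" "x1 \<in> {0..len e1}" "0 < \<psi> e1 x1"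
    and nonpos: "e0 \<in> arcs G" "x0 \<in> {0..len e0}" "\<psi> e0 x0 \<le> 0"
    and m: "2 \<le> m"
    and cut: "m \<le> real (edge_connectivity G) \<or> (\<forall>e\<in>arcs G. \<psi> e 0 \<le> 0 \<and> \<psi> e (len e) \<le> 0)"
    and low: "m = 2 \<or> (\<exists>e\<in>arcs G. \<psi> e 0 \<le> 0 \<or> \<psi> e (len e) \<le> 0)"
  shows "m * pi_p p / 2 \<le> (\<mu> / (p - 1)) powr (1/p) * (positive_length G len \<psi> + (m/2 - 1) * max_length G len)"
proof -
  have W: "W1p_graph G len p \<psi> \<psi>'" using eig unfolding weak_eigenfunction_def by simp
  have prim: "primitive_on (len e) (\<psi> e) (\<psi>' e)" and Lp: "Lp_fun p (len e) (\<psi>' e)" if "e \<in> arcs G" for e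
    using W1p_graph_primitive_on[OF p W that] by auto
  obtain cv where cv: "\<And>e. e \<in> arcs G \<Longrightarrow> \<psi> e 0 = cv (tail G e) \<and> \<psi> e (len e) = cv (head G e)"
    using W unfolding W1p_graph_def continuous_on_graph_def by blast
  obtain es xs where es: "es \<in> arcs G" "xs \<in> {0..len es}"
    and M_ge: "\<And>e x. e \<in> arcs G \<Longrightarrow> x \<in> {0..len e} \<Longrightarrow> \<psi> e x \<le> \<psi> es xs"
    using attains_max[of \<psi>] primitive_onD(1)[OF prim] by blast
  define M where "M = \<psi> es xs"
  have M: "0 < M" using M_ge[OF pos(1,2)] pos(3) unfolding M_def by simp
  define P where "P = cv ` (tail G ` arcs G \<union> head G ` arcs G)"
  have finP: "finite P" "P \<noteq> {}" unfolding P_def using arcs_nonempty by auto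
  define q where "q = max 0 (Min P)"
  define b where "b = max 0 (Max P)"
  have ends: "cv (tail G e) \<in> P" "cv (head G e) \<in> P" if "e \<in> arcs G" for e
    unfolding P_def using that by auto
  have endsP: "Min P \<le> \<psi> e 0" "\<psi> e 0 \<le> Max P" "Min P \<le> \<psi> e (len e)" "\<psi> e (len e) \<le> Max P" if "e \<in> arcs G" for e
    using cv[OF that] ends[OF that] finP by auto
  have P_vert: "\<exists>v\<in>verts G. cv v = z" if "z \<in> P" for z
    using that unfolding P_def by (auto intro: tail_in_verts head_in_verts)
  obtain vx where vx: "vx \<in> verts G" "cv vx = Max P" using P_vert[OF Max_in[OF finP]] by blast
  obtain vy where vy: "vy \<in> verts G" "cv vy = Min P" using P_vert[OF Min_in[OF finP]] by blast
  have MinMax: "Min P \<le> Max P" using finP by (meson Max_ge Min_in)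
  have "Max P \<le> M"
  proof -
    obtain e where "e \<in> arcs G" "Max P = \<psi> e 0 \<or> Max P = \<psi> e (len e)"
      using Max_in[OF finP] cv unfolding P_def by fastforce
    then show ?thesis using M_ge[of e 0] M_ge[of e "len e"] len_pos[of e] unfolding M_def by auto
  qed
  then have qbM: "0 \<le> q" "q \<le> b" "b \<le> M" "0 \<le> b" unfolding q_def b_def using MinMax M by auto
  obtain h where h: "\<And>t. (h has_real_derivative slope_weight p M t) (at t)"
    and kc: "continuous_on UNIV (slope_weight p M)" and hm: "mono h"
    and hM: "h M - h 0 = M powr p * ((p - 1) * pi_p p / (2 * p))"
    using slope_weight_primitive[OF p M] by blast
  have k0: "0 \<le> slope_weight p M t" for t unfolding slope_weight_def by simp
  define v where "v e lo hi x = (if lo < \<psi> e x \<and> \<psi> e x \<le> hi then slope_weight p M (\<psi> e x) * \<bar>\<psi>' e x\<bar> else 0)" for e lo hi x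
  define V where "V e lo hi = (LBINT x:{0<..<len e}. v e lo hi x)" for e lo hi
  \<comment> \<open>the value of \<open>h\<close> after truncation, whose variation \<open>band_variation\<close> estimates\<close>
  define C where "C lo hi t = h (max lo (min hi t))" for lo hi t
  have v_int: "set_integrable lborel {0<..<len e} (v e lo hi)" if "e \<in> arcs G" "lo \<le> hi" for e lo hi
    unfolding v_def by (rule band_variation(1)[OF prim[OF that(1)] h kc k0 that(2)])
  have v_ge: "\<bar>C lo hi (\<psi> e y) - C lo hi (\<psi> e x)\<bar> \<le> (LBINT t:{x<..<y}. v e lo hi t)"
    if "e \<in> arcs G" "lo \<le> hi" "0 \<le> x" "x \<le> y" "y \<le> len e" for e lo hi x y
    unfolding v_def C_def by (rule band_variation(2)[OF prim[OF that(1)] h kc k0 that(2-5)])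
  have V_ge: "\<bar>C lo hi (\<psi> e x) - C lo hi (\<psi> e 0)\<bar> + \<bar>C lo hi (\<psi> e (len e)) - C lo hi (\<psi> e x)\<bar> \<le> V e lo hi"
    if "e \<in> arcs G" "lo \<le> hi" "x \<in> {0..len e}" for e lo hi x
    unfolding V_def using integral_Ioo_split[OF v_int[OF that(1,2)], of x] that
      v_ge[OF that(1,2), of 0 x] v_ge[OF that(1,2), of x "len e"] by simp
  have V_ge_ends: "\<bar>C lo hi (\<psi> e 0) - C lo hi (\<psi> e (len e))\<bar> \<le> V e lo hi" if "e \<in> arcs G" "lo \<le> hi" for e lo hi
    using V_ge[OF that, of 0] len_pos[OF that(1)] by simp
  have V0: "0 \<le> V e lo hi" if "e \<in> arcs G" "lo \<le> hi" for e lo hi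
    using V_ge_ends[OF that] by linarith
  have middle: "m * (h b - h q) \<le> (\<Sum>e\<in>arcs G. V e q b)"
    using cut
  proof
    assume mc: "m \<le> real (edge_connectivity G)"
    have "0 \<le> h b - h q" using monoD[OF hm qbM(2)] by simp
    then have "m * (h b - h q) \<le> real (edge_connectivity G) * (h b - h q)" by (intro mult_right_mono mc)
    also have hbq: "h b - h q = C q b (cv vx) - C q b (cv vy)"
    proof -
      have "max q (min b (Max P)) = b" "max q (min b (Min P)) = q"
        using MinMax unfolding q_def b_def by auto
      then show ?thesis unfolding C_def vx vy by simp
    qed
    also have "real (edge_connectivity G) * (C q b (cv vx) - C q b (cv vy))
      \<le> (\<Sum>e\<in>arcs G. \<bar>C q b (cv (tail G e)) - C q b (cv (head G e))\<bar>)"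
      by (rule edge_connectivity_mult_oscillation_le[OF vx(1) vy(1)])
    also have "\<dots> \<le> (\<Sum>e\<in>arcs G. V e q b)"
      using V_ge_ends[OF _ qbM(2)] cv by (intro sum_mono) metis
    finally show ?thesis unfolding hbq .
  next
    assume "\<forall>e\<in>arcs G. \<psi> e 0 \<le> 0 \<and> \<psi> e (len e) \<le> 0"
    then have "Max P \<le> 0" using Max_in[OF finP] cv unfolding P_def by fastforce
    then have "q = b" using MinMax unfolding q_def b_def by simp
    then show ?thesis using V0[OF _ qbM(2)] by (simp add: sum_nonneg)
  qed
  have bottom: "m * (h q - h 0) \<le> (\<Sum>e\<in>arcs G. V e 0 q)"
  proof (cases "0 < Min P")
    case False
    then have "q = 0" unfolding q_def by simp
    then show ?thesis using V0[OF _ qbM(1)] by (simp add: sum_nonneg)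
  next
    case True
    then have q: "q = Min P" unfolding q_def by simp
    have "m = 2" using low endsP True by fastforce
    have "max 0 (min q (\<psi> e0 x0)) = 0" using nonpos(3) by linarith
    then have "C 0 q (\<psi> e0 x0) = h 0" unfolding C_def by simp
    moreover have "C 0 q (\<psi> e0 0) = h q" "C 0 q (\<psi> e0 (len e0)) = h q"
      unfolding C_def using endsP[OF nonpos(1)] q qbM(1) by (simp_all add: min_def max_def)
    moreover have "h 0 \<le> h q" using monoD[OF hm qbM(1)] .
    ultimately have "2 * (h q - h 0) \<le> V e0 0 q" using V_ge[OF nonpos(1) qbM(1) nonpos(2)] by simp
    also have "\<dots> \<le> (\<Sum>e\<in>arcs G. V e 0 q)"
      by (rule member_le_sum[OF nonpos(1)]) (use V0 qbM in auto)
    finally show ?thesis using \<open>m = 2\<close> by simp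
  qed
  have top: "m * (h M - h b) \<le> m / 2 * V es b M"
  proof -
    have "C b M (\<psi> es xs) = h M" unfolding C_def M_def[symmetric] using qbM by simp
    moreover have "max b (min M (\<psi> es 0)) = b" "max b (min M (\<psi> es (len es))) = b"
      using endsP[OF es(1)] unfolding b_def by linarith+
    then have "C b M (\<psi> es 0) = h b" "C b M (\<psi> es (len es)) = h b" unfolding C_def by simp_all
    moreover have "h b \<le> h M" using monoD[OF hm qbM(3)] .
    ultimately have "2 * (h M - h b) \<le> V es b M" using V_ge[OF es(1) qbM(3) es(2)] by simp
    then have "m / 2 * (2 * (h M - h b)) \<le> m / 2 * V es b M" using m by (intro mult_left_mono) auto
    moreover have "m / 2 * (2 * (h M - h b)) = m * (h M - h b)" by (simp only: mult.assoc[symmetric] times_divide_eq_left)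
    ultimately show ?thesis by (simp only:)
  qed
  \<comment> \<open>slope \<open>m/2\<close> above \<open>b\<close> on \<open>es\<close>, slope \<open>0\<close> on the other edges\<close>
  define c where "c e = (if e = es then m / 2 - 1 else -1)" for e
  have c: "-1 \<le> c e" for e unfolding c_def using m by simp
  define s where "s e x = (if \<psi> e x > 0 then 1 else 0) + c e * (if \<psi> e x > b then 1 else 0)" for e x
  \<comment> \<open>the slope of the test function, level by level: \<open>1\<close> up to \<open>b\<close> and \<open>1 + c e\<close> above\<close>
  have split: "(LBINT x:{0<..<len e}. s e x * (slope_weight p M (\<psi> e x) * \<bar>\<psi>' e x\<bar>))
      = V e 0 q + V e q b + (1 + c e) * V e b M" if e: "e \<in> arcs G" for e
  proof -
    note i1 = v_int[OF e qbM(1)] and i2 = v_int[OF e qbM(2)] and i3 = v_int[OF e qbM(3)]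
    have i4: "set_integrable lborel {0<..<len e} (\<lambda>x. (1 + c e) * v e b M x)" using i3 by simp
    have "(LBINT x:{0<..<len e}. s e x * (slope_weight p M (\<psi> e x) * \<bar>\<psi>' e x\<bar>))
      = (LBINT x:{0<..<len e}. v e 0 q x + v e q b x + (1 + c e) * v e b M x)"
    proof (rule set_lebesgue_integral_cong)
      show "\<forall>x. x \<in> {0<..<len e} \<longrightarrow> s e x * (slope_weight p M (\<psi> e x) * \<bar>\<psi>' e x\<bar>)
        = v e 0 q x + v e q b x + (1 + c e) * v e b M x"
      proof (intro allI impI)
        fix x assume "x \<in> {0<..<len e}"
        then have "\<psi> e x \<le> M" using M_ge[OF e, of x] unfolding M_def by auto
        then show "s e x * (slope_weight p M (\<psi> e x) * \<bar>\<psi>' e x\<bar>)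
          = v e 0 q x + v e q b x + (1 + c e) * v e b M x"
          unfolding s_def v_def using qbM by auto
      qed
    qed simp
    also have "\<dots> = V e 0 q + V e q b + (1 + c e) * V e b M"
      unfolding V_def using set_integral_add(2)[OF set_integral_add(1)[OF i1 i2] i4] set_integral_add(2)[OF i1 i2]
      by simp
    finally show ?thesis .
  qed
  have variation: "m * (h M - h 0)
    \<le> (\<Sum>e\<in>arcs G. LBINT x:{0<..<len e}. s e x * (slope_weight p M (\<psi> e x) * \<bar>\<psi>' e x\<bar>))"
  proof -
    have "(\<Sum>e\<in>arcs G. (1 + c e) * V e b M) = (\<Sum>e\<in>arcs G. if e = es then m / 2 * V es b M else 0)"
      by (intro sum.cong) (auto simp: c_def)
    also have "\<dots> = m / 2 * V es b M" using es(1) by simp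
    finally have "(\<Sum>e\<in>arcs G. V e 0 q + V e q b + (1 + c e) * V e b M)
      = (\<Sum>e\<in>arcs G. V e 0 q) + (\<Sum>e\<in>arcs G. V e q b) + m / 2 * V es b M"
      by (simp add: sum.distrib)
    moreover have "m * (h M - h 0) = m * (h q - h 0) + m * (h b - h q) + m * (h M - h b)"
      by (simp add: algebra_simps)
    ultimately show ?thesis using bottom middle top by (simp add: split)
  qed
  define u where "u e x = max (\<psi> e x) 0 + c e * max (\<psi> e x - b) 0" for e x
  have "W1p_graph G len p u (\<lambda>e x. s e x * \<psi>' e x)"
    unfolding W1p_graph_def continuous_on_graph_def
  proof (intro conjI ballI exI[of _ "\<lambda>v. max (cv v) 0"])
    \<comment> \<open>the slopes above \<open>b\<close> differ from edge to edge, but no vertex value exceeds \<open>b\<close>, so \<open>u\<close> is continuous\<close>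
    fix e assume e: "e \<in> arcs G"
    show "continuous_on {0..len e} (u e)" unfolding u_def
      by (intro continuous_intros primitive_onD(1)[OF prim[OF e]])
    show "u e 0 = max (cv (tail G e)) 0" "u e (len e) = max (cv (head G e)) 0"
      unfolding u_def using endsP[OF e] cv[OF e] by (auto simp: b_def max_def)
    show "sobolev_deriv p (len e) (u e) (\<lambda>x. s e x * \<psi>' e x)" unfolding u_def s_def
      by (rule test_sobolev_deriv[OF len_pos[OF e] _ prim[OF e] Lp[OF e]]) (use p in simp)
  qed
  then have weak: "graph_integral G len (\<lambda>e x. \<bar>\<psi>' e x\<bar> powr (p - 2) * \<psi>' e x * (s e x * \<psi>' e x)) =
        \<mu> * graph_integral G len (\<lambda>e x. \<bar>\<psi> e x\<bar> powr (p - 2) * \<psi> e x * u e x)"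
    using eig unfolding weak_eigenfunction_def by blast
  define \<kappa> where "\<kappa> = \<mu> / (p - 1)"
  have \<kappa>: "0 < \<kappa>" "\<mu> = (p - 1) * \<kappa>" unfolding \<kappa>_def using p \<mu> by auto
  let ?X = "positive_length G len \<psi> + (m / 2 - 1) * len es"
  define J where "J e = (LBINT x:{0<..<len e}. s e x * (slope_weight p M (\<psi> e x) * \<bar>\<psi>' e x\<bar>))" for e
  define A where "A e = measure lborel {x \<in> {0<..<len e}. 0 < \<psi> e x}" for e
  have "(\<Sum>e\<in>arcs G. p * \<kappa> powr (1 - 1/p) * J e - \<mu> * M powr p * (A e + max (c e) 0 * len e))
    \<le> (\<Sum>e\<in>arcs G. (LBINT x:{0<..<len e}. \<bar>\<psi>' e x\<bar> powr (p - 2) * \<psi>' e x * (s e x * \<psi>' e x))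
        - \<mu> * (LBINT x:{0<..<len e}. \<bar>\<psi> e x\<bar> powr (p - 2) * \<psi> e x * u e x))"
    unfolding J_def A_def s_def u_def \<kappa>(2)
    by (intro sum_mono edge_energy_bound p \<kappa>(1) len_pos prim Lp qbM c) (use M_ge in \<open>auto simp: M_def\<close>)
  also have "\<dots> = 0" using weak unfolding graph_integral_def by (simp add: sum_subtractf sum_distrib_left)
  finally have "p * \<kappa> powr (1 - 1/p) * (\<Sum>e\<in>arcs G. J e)
      \<le> \<mu> * M powr p * (\<Sum>e\<in>arcs G. A e + max (c e) 0 * len e)"
    by (simp add: sum_subtractf sum_distrib_left)
  also have "(\<Sum>e\<in>arcs G. A e + max (c e) 0 * len e) = ?X"
  proof -
    have "(\<Sum>e\<in>arcs G. max (c e) 0 * len e) = (\<Sum>e\<in>arcs G. if e = es then (m / 2 - 1) * len es else 0)"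
      by (intro sum.cong) (use m in \<open>auto simp: c_def\<close>)
    also have "\<dots> = (m / 2 - 1) * len es" using es(1) by simp
    finally show ?thesis unfolding positive_length_def A_def by (simp add: sum.distrib)
  qed
  finally have 1: "p * \<kappa> powr (1 - 1/p) * (\<Sum>e\<in>arcs G. J e) \<le> \<mu> * M powr p * ?X" .
  have "p * \<kappa> powr (1 - 1/p) * (m * (h M - h 0)) \<le> p * \<kappa> powr (1 - 1/p) * (\<Sum>e\<in>arcs G. J e)"
    using variation p unfolding J_def by (intro mult_left_mono) auto
  also note 1
  also have "p * \<kappa> powr (1 - 1/p) * (m * (h M - h 0)) = ((p - 1) * M powr p * \<kappa> powr (1 - 1/p)) * (m * pi_p p / 2)"
    unfolding hM using p by (simp add: field_simps)
  also have "\<mu> * M powr p * ?X = ((p - 1) * M powr p * \<kappa> powr (1 - 1/p)) * (\<kappa> powr (1/p) * ?X)"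
  proof -
    have "\<kappa> = \<kappa> powr (1 - 1/p) * \<kappa> powr (1/p)" using \<kappa>(1) by (simp add: powr_add[symmetric])
    then show ?thesis unfolding \<kappa>(2) by (simp add: ac_simps)
  qed
  finally have "m * pi_p p / 2 \<le> \<kappa> powr (1/p) * ?X"
    using p M \<kappa>(1) by (subst (asm) mult_le_cancel_left_pos) auto
  also have "\<dots> \<le> \<kappa> powr (1/p) * (positive_length G len \<psi> + (m / 2 - 1) * max_length G len)"
  proof -
    have "len es \<le> max_length G len" unfolding max_length_def using es(1) by simp
    then show ?thesis using m by (intro mult_left_mono add_left_mono) auto
  qed
  finally show ?thesis unfolding \<kappa>_def .
qed

end

section \<open>From eigenfunctions to the spectral gap\<close>

lemma set_lebesgue_integral_minus:
  fixes f :: "'a \<Rightarrow> real"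
  shows "set_lebesgue_integral M A (\<lambda>x. - f x) = - set_lebesgue_integral M A f"
  unfolding set_lebesgue_integral_def by simp

lemma sobolev_deriv_uminus:
  assumes "sobolev_deriv p l f f'"
  shows "sobolev_deriv p l (\<lambda>x. - f x) (\<lambda>x. - f' x)"
proof -
  have "Lp_fun p l (\<lambda>x. - g x)" if "Lp_fun p l g" for g
    using that borel_measurable_uminus unfolding Lp_fun_def set_borel_measurable_def by fastforce
  then show ?thesis using assms unfolding sobolev_deriv_def by (simp add: set_lebesgue_integral_minus)
qed

context metric_graph
begin

lemma weak_eigenfunction_uminus:
  assumes "weak_eigenfunction G len p \<mu> \<psi> \<psi>'"
  shows "weak_eigenfunction G len p \<mu> (\<lambda>e x. - \<psi> e x) (\<lambda>e x. - \<psi>' e x)"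
proof -
  have W: "W1p_graph G len p \<psi> \<psi>'" using assms unfolding weak_eigenfunction_def by simp
  then obtain c where "\<forall>e\<in>arcs G. \<psi> e 0 = c (tail G e) \<and> \<psi> e (len e) = c (head G e)"
    unfolding W1p_graph_def continuous_on_graph_def by blast
  then have "\<exists>c. \<forall>e\<in>arcs G. - \<psi> e 0 = c (tail G e) \<and> - \<psi> e (len e) = c (head G e)"
    by (intro exI[of _ "\<lambda>v. - c v"]) simp
  then have "W1p_graph G len p (\<lambda>e x. - \<psi> e x) (\<lambda>e x. - \<psi>' e x)"
    using W sobolev_deriv_uminus unfolding W1p_graph_def continuous_on_graph_def
    by (auto intro: continuous_on_minus)
  moreover have "graph_integral G len (\<lambda>e x. - k e x) = - graph_integral G len k" for k
    unfolding graph_integral_def by (simp add: sum_negf set_lebesgue_integral_minus)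
  ultimately show ?thesis using assms unfolding weak_eigenfunction_def by simp
qed

text \<open>
Testing with the constant \<open>1\<close> shows that the integral of \<open>|\<psi>|^(p-2) \<psi>\<close> is \<open>0\<close>, so \<open>\<psi>\<close> cannot be
nonpositive everywhere without vanishing.
\<close>

lemma weak_eigenfunction_positive_somewhere:
  assumes p: "1 < p" and \<mu>: "0 < \<mu>" and eig: "weak_eigenfunction G len p \<mu> \<psi> \<psi>'"
    and nz: "e1 \<in> arcs G" "x1 \<in> {0..len e1}" "\<psi> e1 x1 \<noteq> 0"
  shows "\<exists>e\<in>arcs G. \<exists>x\<in>{0..len e}. 0 < \<psi> e x"
proof (rule ccontr)
  assume "\<not> ?thesis"
  then have neg: "\<psi> e x \<le> 0" if "e \<in> arcs G" "x \<in> {0..len e}" for e x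
    using that by (meson not_le)
  have W: "W1p_graph G len p \<psi> \<psi>'" using eig unfolding weak_eigenfunction_def by simp
  then have cont: "continuous_on {0..len e} (\<psi> e)" if "e \<in> arcs G" for e
    using that unfolding W1p_graph_def continuous_on_graph_def by blast
  have "W1p_graph G len p (\<lambda>e x. 1) (\<lambda>e x. 0)"
    unfolding W1p_graph_def continuous_on_graph_def
    by (intro conjI ballI exI[of _ "\<lambda>v. 1"] primitive_on_imp_sobolev_deriv len_pos primitive_on_const)
      (use p in \<open>auto simp: Lp_fun_def set_borel_measurable_def set_integrable_def\<close>)
  then have "graph_integral G len (\<lambda>e x. \<bar>\<psi>' e x\<bar> powr (p - 2) * \<psi>' e x * 0)
      = \<mu> * graph_integral G len (\<lambda>e x. \<bar>\<psi> e x\<bar> powr (p - 2) * \<psi> e x * 1)"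
    using eig unfolding weak_eigenfunction_def by blast
  then have "\<mu> * graph_integral G len (\<lambda>e x. \<bar>\<psi> e x\<bar> powr (p - 2) * \<psi> e x) = 0"
    unfolding graph_integral_def set_lebesgue_integral_def by simp
  then have zero: "(\<Sum>e\<in>arcs G. LBINT x:{0<..<len e}. \<bar>\<psi> e x\<bar> powr (p - 2) * \<psi> e x) = 0"
    using \<mu> unfolding graph_integral_def by simp
  define w where "w e x = \<bar>\<psi> e x\<bar> powr (p - 1)" for e x
  have w: "(LBINT x:{0<..<len e}. \<bar>\<psi> e x\<bar> powr (p - 2) * \<psi> e x) = - (LBINT x:{0<..<len e}. w e x)"
    if e: "e \<in> arcs G" for e
  proof -
    have "(LBINT x:{0<..<len e}. \<bar>\<psi> e x\<bar> powr (p - 2) * \<psi> e x) = (LBINT x:{0<..<len e}. - w e x)"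
    proof (rule set_lebesgue_integral_cong)
      show "\<forall>x. x \<in> {0<..<len e} \<longrightarrow> \<bar>\<psi> e x\<bar> powr (p - 2) * \<psi> e x = - w e x"
      proof (intro allI impI)
        fix x assume "x \<in> {0<..<len e}"
        then have "\<psi> e x \<le> 0" using neg[OF e] by simp
        then show "\<bar>\<psi> e x\<bar> powr (p - 2) * \<psi> e x = - w e x"
          unfolding w_def using powr_add[of "- \<psi> e x" "p - 2" 1] by (cases "\<psi> e x = 0") auto
      qed
    qed simp
    then show ?thesis by (simp add: set_lebesgue_integral_minus)
  qed
  have wc: "continuous_on {0..len e} (w e)" if "e \<in> arcs G" for e
    unfolding w_def by (intro continuous_on_powr' continuous_intros cont that) (use p in auto)
  have wi: "set_integrable lborel {0<..<len e} (w e)" if "e \<in> arcs G" for e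
    by (rule set_integrable_subset[OF borel_integrable_atLeastAtMost'[OF wc[OF that]]]) auto
  have w0: "0 \<le> (LBINT x:{0<..<len e}. w e x)" for e
    unfolding set_lebesgue_integral_def by (rule integral_nonneg_AE) (simp add: w_def)
  have "(\<Sum>e\<in>arcs G. LBINT x:{0<..<len e}. w e x) = 0"
    using zero by (simp add: w sum_negf)
  then have "(LBINT x:{0<..<len e1}. w e1 x) = 0"
    using w0 nz(1) by (simp add: sum_nonneg_eq_0_iff)
  then have "(w e1 has_integral 0) {0..len e1}"
    unfolding has_integral_Icc_iff_Ioo
    using set_borel_integral_eq_integral[OF wi[OF nz(1)]] by (simp add: has_integral_iff)
  then have "w e1 x1 = 0"
    using has_integral_0_cbox_imp_0[of 0 "len e1" "w e1" x1] wc[OF nz(1)] nz(2) len_pos[OF nz(1)]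
    by (simp add: w_def)
  then show False using nz(3) unfolding w_def by simp
qed

lemma positive_length_uminus:
  assumes "\<And>e. e \<in> arcs G \<Longrightarrow> continuous_on {0..len e} (\<psi> e)"
  shows "positive_length G len \<psi> + positive_length G len (\<lambda>e x. - \<psi> e x) \<le> total_length G len"
  unfolding positive_length_def total_length_def sum.distrib[symmetric]
proof (rule sum_mono)
  fix e assume e: "e \<in> arcs G"
  let ?A = "{x \<in> {0<..<len e}. 0 < \<psi> e x}" and ?B = "{x \<in> {0<..<len e}. 0 < - \<psi> e x}"
  have A: "?A \<in> sets lborel" and B: "?B \<in> sets lborel"
    using superlevel_measurable[OF assms[OF e], of 0]
      superlevel_measurable[OF continuous_on_minus[OF assms[OF e]], of 0] by auto
  have box: "{0<..<len e} \<in> fmeasurable lborel" using len_pos[OF e] by (auto simp: fmeasurable_def)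
  have fA: "?A \<in> fmeasurable lborel" by (rule fmeasurableI2[OF box _ A]) blast
  have fB: "?B \<in> fmeasurable lborel" by (rule fmeasurableI2[OF box _ B]) blast
  have "measure lborel ?A + measure lborel ?B = measure lborel (?A \<union> ?B)"
  proof (rule measure_Union[symmetric])
    show "emeasure lborel ?A \<noteq> \<infinity>" "emeasure lborel ?B \<noteq> \<infinity>"
      using fmeasurableD2[OF fA] fmeasurableD2[OF fB] by simp_all
    show "?A \<inter> ?B = {}" by auto
  qed (rule A B)+
  also have "\<dots> \<le> measure lborel {0<..<len e}"
    by (rule measure_mono_fmeasurable[OF _ sets.Un[OF A B] box]) blast
  also have "\<dots> = len e" using len_pos[OF e] by simp
  finally show "measure lborel ?A + measure lborel ?B \<le> len e" .
qed

lemma len_le_max_length: "e \<in> arcs G \<Longrightarrow> len e \<le> max_length G len"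
  unfolding max_length_def by simp

lemma max_length_pos: "0 < max_length G len"
proof -
  obtain e where "e \<in> arcs G" using arcs_nonempty by auto
  then show ?thesis using len_pos[of e] len_le_max_length[of e] by simp
qed

lemma total_length_pos: "0 < total_length G len"
  unfolding total_length_def using arcs_nonempty len_pos by (intro sum_pos) auto

text \<open>
If some vertex value is nonpositive, \<open>superlevel_length_estimate\<close> applies with \<open>m\<close> itself. Otherwise it
applies with \<open>2\<close>, which is enough for \<open>L \<le> 2 l\<close>, because then \<open>m L / 2 \<le> L + l (m - 2)\<close>. If \<open>L > 2 l\<close>,
it is used for \<open>-\<psi>\<close>, where every \<open>n \<ge> 2\<close> is allowed: for large \<open>n\<close> it shows \<open>pi_p \<le> K l\<close>, and
\<open>m l \<le> L + l (m - 2)\<close>.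
\<close>

lemma weak_eigenfunction_root_bound:
  assumes p: "1 < p" and \<mu>: "0 < \<mu>" and eig: "weak_eigenfunction G len p \<mu> \<psi> \<psi>'"
    and pos: "e1 \<in> arcs G" "x1 \<in> {0..len e1}" "0 < \<psi> e1 x1"
    and neg: "e0 \<in> arcs G" "x0 \<in> {0..len e0}" "\<psi> e0 x0 < 0"
    and half: "positive_length G len \<psi> \<le> total_length G len / 2"
    and m: "2 \<le> m" "m \<le> real (edge_connectivity G)"
  shows "m * pi_p p \<le> (\<mu> / (p - 1)) powr (1/p) * (total_length G len + max_length G len * (m - 2))"
proof -
  define L where "L = total_length G len"
  define l where "l = max_length G len"
  define K where "K = (\<mu> / (p - 1)) powr (1/p)"
  have K: "0 \<le> K" unfolding K_def by simp
  have est: "n * pi_p p \<le> K * (L + l * (n - 2))"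
    if n: "2 \<le> n" "n \<le> real (edge_connectivity G)"
      "n = 2 \<or> (\<exists>e\<in>arcs G. \<psi> e 0 \<le> 0 \<or> \<psi> e (len e) \<le> 0)" for n
  proof -
    have "n * pi_p p / 2 \<le> K * (positive_length G len \<psi> + (n / 2 - 1) * l)"
      unfolding K_def l_def
      by (rule superlevel_length_estimate[OF p \<mu> eig pos neg(1,2) less_imp_le[OF neg(3)] n(1) disjI1[OF n(2)] n(3)])
    also have "\<dots> \<le> K * (L / 2 + (n / 2 - 1) * l)"
      using K half unfolding L_def by (intro mult_left_mono add_right_mono)
    finally show ?thesis by (simp add: algebra_simps)
  qed
  have "m * pi_p p \<le> K * (L + l * (m - 2))"
  proof (cases "\<exists>e\<in>arcs G. \<psi> e 0 \<le> 0 \<or> \<psi> e (len e) \<le> 0")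
    case True
    then show ?thesis using est m by blast
  next
    case False
    have two: "2 * pi_p p \<le> K * L" using est[of 2] m by simp
    show ?thesis
    proof (cases "L \<le> 2 * l")
      case True
      have "m / 2 * (2 * pi_p p) \<le> m / 2 * (K * L)" using two m by (intro mult_left_mono) auto
      then have "m * pi_p p \<le> K * (m / 2 * L)" by (simp add: ac_simps)
      also have "\<dots> \<le> K * (L + l * (m - 2))"
      proof (rule mult_left_mono[OF _ K])
        have "(m - 2) / 2 * L \<le> (m - 2) / 2 * (2 * l)" using True m by (intro mult_left_mono) auto
        moreover have "(m - 2) / 2 * L = m / 2 * L - L" "(m - 2) / 2 * (2 * l) = l * (m - 2)"
          by (simp_all add: field_simps)
        ultimately show "m / 2 * L \<le> L + l * (m - 2)" by linarith
      qed
      finally show ?thesis .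
    next
      case lL: False
      let ?a = "positive_length G len (\<lambda>e x. - \<psi> e x)"
      have all: "\<forall>e\<in>arcs G. - \<psi> e 0 \<le> 0 \<and> - \<psi> e (len e) \<le> 0"
        using False by (auto simp: not_le intro: less_imp_le)
      then have ex: "\<exists>e\<in>arcs G. - \<psi> e 0 \<le> 0 \<or> - \<psi> e (len e) \<le> 0" using pos(1) by blast
      have bump: "n * pi_p p / 2 \<le> K * (?a + (n / 2 - 1) * l)" if "2 \<le> n" for n
        unfolding K_def l_def
        by (rule superlevel_length_estimate[OF p \<mu> weak_eigenfunction_uminus[OF eig] neg(1,2) _ pos(1,2) _ that
              disjI2[OF all] disjI2[OF ex]])
          (use neg(3) pos(3) in auto)
      have "pi_p p \<le> K * l"
      proof (rule ccontr)
        assume "\<not> ?thesis"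
        then have d: "0 < pi_p p - K * l" by simp
        \<comment> \<open>\<open>n\<close> is so large that the terms proportional to \<open>n\<close> in \<open>bump\<close> outweigh the constant one\<close>
        define n where "n = 2 + 2 * \<bar>K * (?a - l)\<bar> / (pi_p p - K * l)"
        have "2 \<le> n" unfolding n_def using d by simp
        from bump[OF this] have "n / 2 * (pi_p p - K * l) \<le> K * (?a - l)" by (simp add: algebra_simps)
        moreover have "n / 2 * (pi_p p - K * l) = (pi_p p - K * l) + \<bar>K * (?a - l)\<bar>"
          unfolding n_def using d by (simp add: field_simps)
        ultimately show False using d by linarith
      qed
      then have "m * pi_p p \<le> m * (K * l)" using m by (intro mult_left_mono) auto
      also have "\<dots> = K * (m * l)" by simp
      also have "\<dots> \<le> K * (L + l * (m - 2))"
        by (rule mult_left_mono[OF _ K]) (use lL in \<open>simp add: algebra_simps\<close>)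
      finally show ?thesis .
    qed
  qed
  then show ?thesis unfolding K_def L_def l_def .
qed

lemma pi_p_nonneg: "1 < p \<Longrightarrow> 0 \<le> pi_p p"
  unfolding pi_p_def by (intro divide_nonneg_nonneg mult_nonneg_nonneg sin_ge_zero) (auto simp: field_simps)

text \<open>
The sets \<open>{\<psi> > 0}\<close> and \<open>{\<psi> < 0}\<close> are disjoint, so one of them has length at most \<open>L/2\<close>; the bound of
\<open>weak_eigenfunction_root_bound\<close> then holds for \<open>\<psi>\<close> or for \<open>-\<psi>\<close>.
\<close>

lemma p_eigenvalue_lower_bound:
  assumes p: "1 < p" and \<mu>: "0 < \<mu>" and ev: "p_eigenvalue G len p \<mu>"
    and m: "2 \<le> m" "m \<le> real (edge_connectivity G)"
  shows "(p - 1) * (m * pi_p p / (total_length G len + max_length G len * (m - 2))) powr p \<le> \<mu>"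
proof -
  let ?D = "total_length G len + max_length G len * (m - 2)"
  obtain \<psi> \<psi>' where eig: "weak_eigenfunction G len p \<mu> \<psi> \<psi>'"
    and nz: "\<exists>e\<in>arcs G. \<exists>x\<in>{0..len e}. \<psi> e x \<noteq> 0"
    using ev unfolding p_eigenvalue_def weak_eigenfunction_def by blast
  note eig' = weak_eigenfunction_uminus[OF eig]
  obtain e1 x1 where pos: "e1 \<in> arcs G" "x1 \<in> {0..len e1}" "0 < \<psi> e1 x1"
    using weak_eigenfunction_positive_somewhere[OF p \<mu> eig] nz by blast
  obtain e0 x0 where neg: "e0 \<in> arcs G" "x0 \<in> {0..len e0}" "\<psi> e0 x0 < 0"
    using weak_eigenfunction_positive_somewhere[OF p \<mu> eig' pos(1,2)] pos(3) by auto
  have "continuous_on {0..len e} (\<psi> e)" if "e \<in> arcs G" for e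
    using eig that unfolding weak_eigenfunction_def W1p_graph_def continuous_on_graph_def by blast
  then have "positive_length G len \<psi> + positive_length G len (\<lambda>e x. - \<psi> e x) \<le> total_length G len"
    by (rule positive_length_uminus)
  then consider "positive_length G len \<psi> \<le> total_length G len / 2"
    | "positive_length G len (\<lambda>e x. - \<psi> e x) \<le> total_length G len / 2" by linarith
  then have "m * pi_p p \<le> (\<mu> / (p - 1)) powr (1/p) * ?D"
  proof cases
    case 1
    then show ?thesis by (rule weak_eigenfunction_root_bound[OF p \<mu> eig pos neg _ m])
  next
    case 2
    have "0 < - \<psi> e0 x0" "- \<psi> e1 x1 < 0" using pos(3) neg(3) by simp_all
    then show ?thesis
      by (rule weak_eigenfunction_root_bound[OF p \<mu> eig' neg(1,2) _ pos(1,2) _ 2 m])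
  qed
  moreover have "0 < ?D" using total_length_pos max_length_pos m by (simp add: add_pos_nonneg)
  ultimately have "m * pi_p p / ?D \<le> (\<mu> / (p - 1)) powr (1/p)" by (simp add: field_simps)
  moreover have "0 \<le> m * pi_p p / ?D" using pi_p_nonneg[OF p] m \<open>0 < ?D\<close> by simp
  ultimately have "(m * pi_p p / ?D) powr p \<le> ((\<mu> / (p - 1)) powr (1/p)) powr p"
    using p by (intro powr_mono2) auto
  also have "\<dots> = \<mu> / (p - 1)" using p \<mu> by (simp add: powr_powr)
  finally show ?thesis using p by (simp add: field_simps)
qed

end

theorem theorem3p4:
  fixes G :: "('v, 'e) pre_digraph" and len :: "'e \<Rightarrow> real" and p :: real
  assumes "metric_graph G len" and "1 < p"
  shows "(edge_connectivity G \<ge> 2 \<longrightarrow>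
            mu1 G len p \<ge> ereal ((p - 1) * (2 * pi_p p / total_length G len) powr p)) \<and>
         (edge_connectivity G \<ge> 3 \<longrightarrow>
            mu1 G len p \<ge> ereal ((p - 1) *
              (real (edge_connectivity G) * pi_p p /
                (total_length G len + max_length G len * (real (edge_connectivity G) - 2))) powr p))"
proof -
  interpret metric_graph G len by (rule assms(1))
  have bound: "mu1 G len p \<ge> ereal ((p - 1) * (m * pi_p p / (total_length G len + max_length G len * (m - 2))) powr p)"
    if "2 \<le> m" "m \<le> real (edge_connectivity G)" for m
    unfolding mu1_def le_INF_iff using p_eigenvalue_lower_bound[OF assms(2) _ _ that] by simp
  show ?thesis using bound[of 2] bound[of "real (edge_connectivity G)"] by simp
qed

end
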